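(* Let $q\ge 5$ be an odd prime power and let $m=2^e\ell$, where $\ell\ge 3$ is odd and $e$ is a positive integer. Let $n=(q^m-1)/2$. Then the negacyclic code $\mathcal{C}_{(1,n)}$ over $\mathrm{GF}(q)$ has length $(q^m-1)/2$, dimension $[q^m+(2-q)^m-2]/4$, and minimum distance $d\ge q^{(m-2^e)/2}+q$. The dual code $\mathcal{C}_{(1,n)}^\perp$ has length $(q^m-1)/2$, dimension $[q^m-(2-q)^m]/4$, and minimum distance $d^\perp\ge q^{(m-2^e)/2}+q$.
   Context: Let $q$ be an odd prime power, $m\ge 2$ an integer, $N=q^m-1$, $n=N/2$. For $0\le h\le q^m-1$ with $q$-adic expansion $h=\sum_{j=0}^{m-1}h_jq^j$, $0\le h_j\le q-1$, let $\mathtt{wt}(h)$ be the number of indices $j$ with $h_j\ne 0$. Let $\Omega=\{1+2i: 0\le i\le n-1\}$ (the odd residues modulo $N$) and, for $i\in\{0,1\}$, let $T_{(i,n)}=\{h\in\Omega: \mathtt{wt}(h)\equiv i \pmod 2\}$; this set is closed under multiplication by $q$ modulo $N$. A linear code of length $n$ over $\mathrm{GF}(q)$ is identified with a subspace of $\mathrm{GF}(q)[x]/(x^n+1)$ via $(c_0,\dots,c_{n-1})\mapsto \sum_j c_jx^j$; it is negacyclic if it is an ideal there, and its generator polynomial is then the monic divisor of $x^n+1$ generating it. Fix a primitive element $\beta$ of $\mathrm{GF}(q^m)$, so $\beta^n=-1$ and the roots of $x^n+1$ are $\beta^i$, $i\in\Omega$. The negacyclic code with defining set $Z\subseteq\Omega$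 is the one with generator polynomial $\prod_{i\in Z}(x-\beta^i)$. $\mathcal{C}_{(i,n)}$ is the negacyclic code of length $n$ over $\mathrm{GF}(q)$ with defining set $T_{(i,n)}$. Minimum distance is Hamming distance, and $\mathcal{C}^\perp$ is the dual with respect to the standard (Euclidean) inner product on $\mathrm{GF}(q)^n$. *)

theory Defs
  imports "Jordan_Normal_Form.VS_Connect"
begin

definition linear_code :: "nat \<Rightarrow> 'a :: field vec set \<Rightarrow> bool" where
  "linear_code n C \<longleftrightarrow> VectorSpace.subspace class_ring C (module_vec TYPE('a) n)"

definition code_dim :: "nat \<Rightarrow> 'a :: field vec set \<Rightarrow> nat" where
  "code_dim n C = vectorspace.dim class_ring (module_vec TYPE('a) n \<lparr>carrier := C\<rparr>)"

definition dual_code :: "nat \<Rightarrow> 'a :: field vec set \<Rightarrow> 'a vec set" where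
  "dual_code n C = vec_module.orthogonal_complement n C"

definition hamming_dist :: "'a vec \<Rightarrow> 'a vec \<Rightarrow> nat" where
  "hamming_dist u v = card {i. i < dim_vec u \<and> u $ i \<noteq> v $ i}"

text \<open>As \<^term>\<open>Inf {} = (0 :: nat)\<close>, a code with fewer than two words has minimum distance 0 here.\<close>

definition min_dist :: "'a vec set \<Rightarrow> nat" where
  "min_dist C = Inf {hamming_dist u v | u v. u \<in> C \<and> v \<in> C \<and> u \<noteq> v}"

text \<open>For \<open>n > 0\<close>, an element of \<open>F[x]/(x^n + 1)\<close> is represented by its unique representative of
  degree below \<open>n\<close>; \<open>poly_of_word\<close> and \<open>word_of_poly\<close> identify the quotient ring with \<open>F^n\<close>
  via \<open>(c\<^sub>0, \<dots>, c\<^sub>n\<^sub>-\<^sub>1) \<mapsto> \<Sum>j. c\<^sub>j x^j\<close>.\<close>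

definition poly_of_word :: "'a :: zero vec \<Rightarrow> 'a poly" where
  "poly_of_word c = Poly (list_of_vec c)"

definition word_of_poly :: "nat \<Rightarrow> 'a :: field poly \<Rightarrow> 'a vec" where
  "word_of_poly n p = vec n (coeff (p mod (monom 1 n + 1)))"

text \<open>A linear code is an ideal of the quotient ring iff it absorbs multiplication.\<close>

definition negacyclic_code :: "nat \<Rightarrow> 'a :: field vec set \<Rightarrow> bool" where
  "negacyclic_code n C \<longleftrightarrow>
     linear_code n C \<and> (\<forall>a. \<forall>c\<in>C. word_of_poly n (a * poly_of_word c) \<in> C)"

definition generator_poly :: "nat \<Rightarrow> 'a :: field vec set \<Rightarrow> 'a poly \<Rightarrow> bool" where
  "generator_poly n C g \<longleftrightarrow>
     lead_coeff g = 1 \<and> g dvd monom 1 n + 1 \<and> C = range (\<lambda>a. word_of_poly n (a * g))"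

definition primitive_element :: "'b :: field \<Rightarrow> bool" where
  "primitive_element \<beta> \<longleftrightarrow> range (\<lambda>k::nat. \<beta> ^ k) = UNIV - {0}"

text \<open>The map \<open>\<phi>\<close> embeds the ground field in the extension field that contains \<open>\<beta>\<close>. The code is
  well defined whenever the product below has all its coefficients in the image of \<open>\<phi>\<close> and
  divides \<open>x^n + 1\<close>: the generator polynomial over the ground field is then unique, since \<open>\<phi>\<close> is
  injective, and it determines the code.\<close>

definition code_of_defining_set ::
  "('a :: field \<Rightarrow> 'b :: field) \<Rightarrow> 'b \<Rightarrow> nat \<Rightarrow> nat set \<Rightarrow> 'a vec set" where
  "code_of_defining_set \<phi> \<beta> n Z =
     (THE C. negacyclic_code n C \<and>
        (\<exists>g. generator_poly n C g \<and> map_poly \<phi> g = (\<Prod>i\<in>Z. [:- (\<beta> ^ i), 1:])))"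

definition digit_weight :: "nat \<Rightarrow> nat \<Rightarrow> nat \<Rightarrow> nat" where
  "digit_weight q m h = card {j. j < m \<and> (h div q ^ j) mod q \<noteq> 0}"

definition Omega :: "nat \<Rightarrow> nat set" where
  "Omega n = {1 + 2 * i | i. i < n}"

definition T_set :: "nat \<Rightarrow> nat \<Rightarrow> nat \<Rightarrow> nat set" where
  "T_set q m i = {h \<in> Omega ((q ^ m - 1) div 2). digit_weight q m h mod 2 = i mod 2}"

end

theory Submission
  imports Defs "Jordan_Normal_Form.Char_Poly" "HOL-Number_Theory.Cong"
begin

text \<open>Put \<open>k = (m - 2^e) / 2\<close>. For \<open>- (q - 2) \<le> i \<le> q^k\<close> the number
  \<open>c q^(2k) + i (q^k + 1)\<close> has a digit weight whose parity does not depend on \<open>i\<close>, if \<open>c = q\<close>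
  (odd weight) or \<open>c = 2q - 1\<close> (even weight). Since \<open>q^k + 1\<close> and \<open>q^m - 1\<close> have greatest common
  divisor 2, each of the sets \<open>T_set q m 1\<close> and \<open>T_set q m 0\<close> contains an arithmetic progression of
  length \<open>q^k + q - 1\<close> to which the BCH bound applies. The zeros of the code are the \<open>\<beta>^i\<close> with \<open>i\<close>
  of odd weight, those of the dual code the \<open>\<beta>^(-i)\<close> with \<open>i\<close> of even weight, and this gives both
  distances. The dimensions are the numbers of exponents of even and of odd weight; these are
  character sums over digit strings.\<close>

section \<open>Linear codes over finite fields\<close>

text \<open>The range of \<open>i\<close> is as long as possible: at \<open>i = q^k + 1\<close> the
  blocks are \<open>1, 2, c + 1\<close>, and at \<open>i = - (q - 1)\<close> the middle block is
  \<open>q^k - q\<close>, whose last digit is 0; either change flips the parity. Within the range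
  the condition on \<open>c\<close> is that \<open>c - 1\<close> and \<open>c\<close> have weights
  of one parity and \<open>c + 1\<close> of the other, and that \<open>c\<close> is odd, since all
  exponents have to be odd. Negation modulo \<open>q^m - 1\<close> does not respect the parity of
  the weight, so the zeros of the dual code are not described by a set \<open>T_set\<close>. The
  exponents are therefore kept and \<open>\<beta>\<close> is inverted: the BCH bound is applied to
  powers of \<open>1 / \<beta>\<close>. The ground field and the field of \<open>\<beta>\<close> are
  separate types linked by \<open>\<phi>\<close>. Before anything can be said about the code, its
  generator polynomial has to be brought down to the ground field, which is done with the Frobenius
  map. Dimensions enter only through cardinalities of codes.\<close>

lemma (in vectorspace) card_eq_power_dim:
  assumes "finite (carrier V)"
  shows "card (carrier V) = card (carrier K) ^ dim"
proof -
  have "fin_dim"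
    unfolding fin_dim_def using assms span_is_subset2[of "carrier V"] in_own_span[of "carrier V"]
    by (intro exI[of _ "carrier V"]) auto
  then obtain B where B: "finite B" "basis B"
    using finite_basis_exists by blast
  have BV: "B \<subseteq> carrier V" and d: "dim = card B"
    using B dim_basis by (auto simp: basis_def)
  have *: "\<forall>v. v \<in> carrier V \<longrightarrow> (\<exists>! a. a \<in> B \<rightarrow>\<^sub>E carrier K \<and> lincomb a B = v)"
    using basis_criterion[OF B(1) BV] B(2) by blast
  have cl: "lincomb a B \<in> carrier V" if "a \<in> B \<rightarrow>\<^sub>E carrier K" for a
    using that lincomb_closed[OF BV, of a] by (simp add: PiE_def)
  have "bij_betw (\<lambda>a. lincomb a B) (B \<rightarrow>\<^sub>E carrier K) (carrier V)"
    unfolding bij_betw_def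
  proof
    show "inj_on (\<lambda>a. lincomb a B) (B \<rightarrow>\<^sub>E carrier K)"
    proof (rule inj_onI)
      fix a b
      assume a: "a \<in> B \<rightarrow>\<^sub>E carrier K" and b: "b \<in> B \<rightarrow>\<^sub>E carrier K"
        and ab: "lincomb a B = lincomb b B"
      have "\<exists>! c. c \<in> B \<rightarrow>\<^sub>E carrier K \<and> lincomb c B = lincomb b B"
        by (rule *[rule_format, OF cl[OF b]])
      then show "a = b"
        by (rule ex1E) (metis a b ab)
    qed
    show "(\<lambda>a. lincomb a B) ` (B \<rightarrow>\<^sub>E carrier K) = carrier V"
    proof (intro equalityI subsetI)
      show "v \<in> carrier V" if "v \<in> (\<lambda>a. lincomb a B) ` (B \<rightarrow>\<^sub>E carrier K)" for v
        using that cl by (elim imageE) simp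
      show "v \<in> (\<lambda>a. lincomb a B) ` (B \<rightarrow>\<^sub>E carrier K)" if "v \<in> carrier V" for v
        using *[rule_format, OF that] by (elim ex1E) (metis image_eqI)
    qed
  qed
  then have "card (carrier V) = card (B \<rightarrow>\<^sub>E carrier K)"
    by (simp add: bij_betw_same_card)
  then show ?thesis
    using B(1) d by (simp add: card_PiE)
qed

lemma card_carrier_vec: "card (carrier_vec n :: 'a :: finite vec set) = card (UNIV :: 'a set) ^ n"
proof -
  have "bij_betw list_of_vec (carrier_vec n :: 'a vec set) {xs. set xs \<subseteq> UNIV \<and> length xs = n}"
  proof (rule bij_betwI[where g = vec_of_list])
    show "list_of_vec \<in> carrier_vec n \<rightarrow> {xs. set xs \<subseteq> UNIV \<and> length xs = n}"
      by (rule Pi_I) (simp add: carrier_vecD)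
    show "vec_of_list \<in> {xs. set xs \<subseteq> UNIV \<and> length xs = n} \<rightarrow> carrier_vec n"
      by (rule Pi_I) (simp add: carrier_vecI)
  qed (simp_all add: vec_list list_vec)
  then show ?thesis
    using card_lists_length_eq[of "UNIV :: 'a set" n] by (simp add: bij_betw_same_card)
qed

lemma finite_carrier_vec: "finite (carrier_vec n :: 'a :: finite vec set)"
  by (rule card_ge_0_finite) (simp add: card_carrier_vec card_gt_0_iff)

lemma linear_code_iff:
  fixes C :: "'a :: field vec set"
  shows "linear_code n C \<longleftrightarrow> C \<subseteq> carrier_vec n \<and> 0\<^sub>v n \<in> C \<and>
    (\<forall>u\<in>C. \<forall>v\<in>C. u + v \<in> C) \<and> (\<forall>a. \<forall>v\<in>C. a \<cdot>\<^sub>v v \<in> C)"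
proof -
  have "vectorspace class_ring (module_vec TYPE('a) n)" "Module.module class_ring (module_vec TYPE('a) n)"
    using vec_vs[where ?'a = 'a and n = n] vec_module[where ?'a = 'a and n = n]
    unfolding class_field_def by simp_all
  then show ?thesis
    unfolding linear_code_def VectorSpace.subspace_def submodule_def module_vec_simps by auto
qed

text \<open>Over a finite field the dimension is the logarithm of the number of words, so every
  claim about dimensions becomes a matter of counting.\<close>

lemma linear_code_dim:
  fixes C :: "'a :: {field, finite} vec set"
  assumes "linear_code n C"
  shows "card C = card (UNIV :: 'a set) ^ code_dim n C"
proof -
  interpret V: vectorspace class_ring "module_vec TYPE('a) n"
    using vec_vs[where ?'a = 'a and n = n] unfolding class_field_def .
  interpret W: vectorspace class_ring "module_vec TYPE('a) n \<lparr>carrier := C\<rparr>"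
    using V.subspace_is_vs[OF assms[unfolded linear_code_def]] .
  have "finite C"
    using assms finite_carrier_vec finite_subset unfolding linear_code_iff by blast
  then show ?thesis
    using W.card_eq_power_dim unfolding code_dim_def by simp
qed

lemma dual_code_iff:
  "v \<in> dual_code n C \<longleftrightarrow> v \<in> carrier_vec n \<and> (\<forall>y\<in>C. v \<bullet> y = 0)"
  unfolding dual_code_def vec_module.orthogonal_complement_def by simp

lemma linear_code_dual:
  assumes "C \<subseteq> carrier_vec n"
  shows "linear_code n (dual_code n C)"
proof -
  have "\<And>y. y \<in> C \<Longrightarrow> y \<in> carrier_vec n"
    using assms by blast
  then show ?thesis
    unfolding linear_code_iff by (auto simp: dual_code_iff add_scalar_prod_distrib[of _ n]
        smult_scalar_prod_distrib[of _ n])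
qed

text \<open>By linearity the difference of two distinct words is a nonzero word, and their distance
  is its weight. The bound on \<open>card C\<close> makes the set of distances nonempty, so that
  \<open>min_dist\<close> is attained and not the default value 0.\<close>

lemma min_dist_ge:
  fixes C :: "'a :: field vec set"
  assumes "linear_code n C" and "card C > 1"
    and "\<And>c. c \<in> C \<Longrightarrow> c \<noteq> 0\<^sub>v n \<Longrightarrow> d \<le> card {i. i < n \<and> c $ i \<noteq> 0}"
  shows "d \<le> min_dist C"
proof -
  let ?S = "{hamming_dist u v | u v. u \<in> C \<and> v \<in> C \<and> u \<noteq> v}"
  obtain u v where "u \<in> C" "v \<in> C" "u \<noteq> v"
    using assms(2) by (metis card_le_Suc0_iff_eq card.infinite not_less One_nat_def not_less_zero)
  then have "?S \<noteq> {}"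
    by blast
  then have "Inf ?S \<in> ?S"
    by (rule Inf_nat_def1)
  then obtain u v where uv: "u \<in> C" "v \<in> C" "u \<noteq> v" and m: "min_dist C = hamming_dist u v"
    unfolding min_dist_def by blast
  have cl: "u \<in> carrier_vec n" "v \<in> carrier_vec n"
    using uv assms(1) unfolding linear_code_iff by auto
  have "u + (-1) \<cdot>\<^sub>v v \<in> C"
    using uv assms(1) unfolding linear_code_iff by auto
  moreover have "u + (-1) \<cdot>\<^sub>v v \<noteq> 0\<^sub>v n"
  proof
    assume "u + (-1) \<cdot>\<^sub>v v = 0\<^sub>v n"
    then have "(u + (-1) \<cdot>\<^sub>v v) $ i = 0" if "i < n" for i
      using that by simp
    then have "u = v"
      using cl by (intro eq_vecI) auto
    then show False
      using uv by simp
  qed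
  ultimately have "d \<le> card {i. i < n \<and> (u + (-1) \<cdot>\<^sub>v v) $ i \<noteq> 0}"
    by (rule assms(3))
  also have "{i. i < n \<and> (u + (-1) \<cdot>\<^sub>v v) $ i \<noteq> 0} = {i. i < dim_vec u \<and> u $ i \<noteq> v $ i}"
    using cl by auto
  finally show ?thesis
    unfolding m hamming_dist_def .
qed

text \<open>A word \<open>x1\<close> with \<open>x1 \<bullet> y = 1\<close> splits \<open>C\<close>
  into the line through \<open>x1\<close> and the kernel of the functional: every word is
  \<open>a \<cdot>\<^sub>v x1 + x\<close> for exactly one scalar \<open>a\<close> and one
  \<open>x\<close> in the kernel.\<close>

lemma card_kernel_functional:
  fixes C :: "'a :: {field, finite} vec set"
  assumes C: "linear_code n C" and y: "y \<in> carrier_vec n" and "\<exists>x\<in>C. x \<bullet> y \<noteq> 0"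
  shows "card C = card (UNIV :: 'a set) * card {x \<in> C. x \<bullet> y = 0}"
proof -
  obtain x0 where x0: "x0 \<in> C" "x0 \<bullet> y \<noteq> 0"
    using assms by blast
  define x1 where "x1 = (1 / (x0 \<bullet> y)) \<cdot>\<^sub>v x0"
  have Cn: "C \<subseteq> carrier_vec n" and add: "\<And>u v. u \<in> C \<Longrightarrow> v \<in> C \<Longrightarrow> u + v \<in> C"
    and smult: "\<And>a v. v \<in> C \<Longrightarrow> a \<cdot>\<^sub>v v \<in> C"
    using C unfolding linear_code_iff by auto
  have x1: "x1 \<in> C" "x1 \<bullet> y = 1" "x1 \<in> carrier_vec n"
    using x0 Cn smult y by (auto simp: x1_def)
  let ?f = "\<lambda>(a, x). a \<cdot>\<^sub>v x1 + x" and ?g = "\<lambda>x. (x \<bullet> y, x + (- (x \<bullet> y)) \<cdot>\<^sub>v x1)"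
  have dot: "(a \<cdot>\<^sub>v x1 + x) \<bullet> y = a + x \<bullet> y" "(x + a \<cdot>\<^sub>v x1) \<bullet> y = x \<bullet> y + a" if "x \<in> C" for a x
    using that x1 y Cn by (auto simp: add_scalar_prod_distrib[of _ n] subset_iff)
  have "bij_betw ?f (UNIV \<times> {x \<in> C. x \<bullet> y = 0}) C"
  proof (rule bij_betwI[where g = ?g])
    show "?f \<in> UNIV \<times> {x \<in> C. x \<bullet> y = 0} \<rightarrow> C"
      using add smult x1 by auto
    show "?g \<in> C \<rightarrow> UNIV \<times> {x \<in> C. x \<bullet> y = 0}"
      using add smult x1 by (auto simp: dot)
    show "?g (?f p) = p" if "p \<in> UNIV \<times> {x \<in> C. x \<bullet> y = 0}" for p
      using that x1 Cn by (auto simp: dot intro!: eq_vecI)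
    show "?f (?g x) = x" if "x \<in> C" for x
      using that x1 Cn by (auto simp: dot intro!: eq_vecI)
  qed
  then show ?thesis
    by (simp add: bij_betw_same_card[symmetric] card_cartesian_product)
qed


text \<open>The pairs \<open>(x, y)\<close> with \<open>x \<in> C\<close> and \<open>x \<bullet> y = 0\<close> are counted in two ways.\<close>

lemma card_mult_card_dual:
  fixes C :: "'a :: {field, finite} vec set"
  assumes C: "linear_code n C"
  shows "card C * card (dual_code n C) = card (UNIV :: 'a set) ^ n"
proof -
  define q where "q = card (UNIV :: 'a set)"
  define V where "V = (carrier_vec n :: 'a vec set)"
  define D where "D = dual_code n C"
  have "card {0, 1 :: 'a} \<le> q"
    unfolding q_def by (intro card_mono) auto
  then have q: "q \<ge> 2"
    by simp
  have finV: "finite V" and cV: "card V = q ^ n"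
    unfolding V_def q_def by (simp_all add: finite_carrier_vec card_carrier_vec)
  have CV: "C \<subseteq> V" and zC: "0\<^sub>v n \<in> C"
    using C unfolding linear_code_iff V_def by auto
  have finC: "finite C"
    using CV finV finite_subset by blast
  have DV: "D \<subseteq> V"
    by (auto simp: D_def V_def dual_code_iff)
  have finD: "finite D"
    using DV finV finite_subset by blast
  have linV: "linear_code n V"
    unfolding linear_code_iff V_def by simp
  \<comment> \<open>Scaling both counts by \<open>q\<close> avoids the hyperplane size with exponent
    \<open>n - 1\<close> and the division of \<open>card C\<close> by \<open>q\<close>.\<close>
  have left: "real q * real (card {y \<in> V. x \<bullet> y = 0}) = (if x = 0\<^sub>v n then real q * real q ^ n else real q ^ n)"
    if x: "x \<in> C" for x
  proof (cases "x = 0\<^sub>v n")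
    case True
    then have "{y \<in> V. x \<bullet> y = 0} = V"
      by (auto simp: V_def)
    then show ?thesis
      using True cV by simp
  next
    case False
    have xV: "x \<in> carrier_vec n"
      using x CV V_def by blast
    obtain i where i: "i < n" "x $ i \<noteq> 0"
      using False xV by (metis carrier_vecD eq_vecI index_zero_vec(1) index_zero_vec(2))
    then have "unit_vec n i \<bullet> x \<noteq> 0"
      using xV by simp
    moreover have "unit_vec n i \<in> V"
      by (simp add: V_def)
    ultimately have "card V = q * card {y \<in> V. y \<bullet> x = 0}"
      using card_kernel_functional[OF linV xV] unfolding q_def by blast
    also have "{y \<in> V. y \<bullet> x = 0} = {y \<in> V. x \<bullet> y = 0}"
      using xV comm_scalar_prod[of _ n x] by (auto simp: V_def)
    finally have "real (card V) = real q * real (card {y \<in> V. x \<bullet> y = 0})"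
      by simp
    then show ?thesis
      using False cV by simp
  qed
  have right: "real q * real (card {x \<in> C. x \<bullet> y = 0}) = (if y \<in> D then real q * real (card C) else real (card C))"
    if y: "y \<in> V" for y
  proof -
    have comm: "x \<bullet> y = y \<bullet> x" if "x \<in> C" for x
      using that CV y comm_scalar_prod[of x n y] by (auto simp: V_def)
    show ?thesis
    proof (cases "y \<in> D")
      case True
      then have "{x \<in> C. x \<bullet> y = 0} = C"
        using comm by (auto simp: D_def dual_code_iff)
      then show ?thesis
        using True by simp
    next
      case False
      then have "\<exists>x\<in>C. x \<bullet> y \<noteq> 0"
        using y comm by (auto simp: D_def V_def dual_code_iff)
      then have "card C = q * card {x \<in> C. x \<bullet> y = 0}"
        using card_kernel_functional[OF C] y unfolding q_def V_def by blast
      then have "real (card C) = real q * real (card {x \<in> C. x \<bullet> y = 0})"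
        by simp
      then show ?thesis
        using False by simp
    qed
  qed
  have card_sum: "real (card {z \<in> A. P z}) = (\<Sum>z\<in>A. if P z then 1 else 0)" if "finite A" for A :: "'a vec set" and P
    using that by (simp add: sum.If_cases Int_def)
  have "(\<Sum>x\<in>C. real (card {y \<in> V. x \<bullet> y = 0})) = (\<Sum>y\<in>V. real (card {x \<in> C. x \<bullet> y = 0}))"
    unfolding card_sum[OF finV] card_sum[OF finC] by (rule sum.swap)
  then have "(\<Sum>x\<in>C. real q * real (card {y \<in> V. x \<bullet> y = 0}))
      = (\<Sum>y\<in>V. real q * real (card {x \<in> C. x \<bullet> y = 0}))"
    by (simp add: sum_distrib_left[symmetric])
  then have "(\<Sum>x\<in>C. if x = 0\<^sub>v n then real q * real q ^ n else real q ^ n)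
      = (\<Sum>y\<in>V. if y \<in> D then real q * real (card C) else real (card C))"
    using left right by (simp cong: sum.cong)
  moreover have "(\<Sum>x\<in>C. if x = 0\<^sub>v n then real q * real q ^ n else real q ^ n)
      = real (card C) * real q ^ n + (real q - 1) * real q ^ n"
  proof -
    have "(\<Sum>x\<in>C. if x = 0\<^sub>v n then real q * real q ^ n else real q ^ n)
      = (\<Sum>x\<in>C. real q ^ n + (if x = 0\<^sub>v n then (real q - 1) * real q ^ n else 0))"
      by (intro sum.cong) (auto simp: algebra_simps)
    then show ?thesis
      using finC zC by (simp add: sum.distrib)
  qed
  moreover have "(\<Sum>y\<in>V. if y \<in> D then real q * real (card C) else real (card C))
      = real (card V) * real (card C) + (real q - 1) * (real (card D) * real (card C))"
  proof -
    have "(\<Sum>y\<in>V. if y \<in> D then real q * real (card C) else real (card C))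
      = (\<Sum>y\<in>V. real (card C) + (if y \<in> D then (real q - 1) * real (card C) else 0))"
      by (intro sum.cong) (auto simp: algebra_simps)
    also have "\<dots> = real (card V) * real (card C) + (\<Sum>y\<in>V \<inter> D. (real q - 1) * real (card C))"
      unfolding sum.distrib sum.inter_restrict[OF finV] by simp
    also have "V \<inter> D = D"
      using DV by blast
    finally show ?thesis
      by simp
  qed
  \<comment> \<open>As \<open>card V = q ^ n\<close>, the term \<open>card C * q ^ n\<close> occurs
    on both sides and cancels. What is left comes from the zero word on one side and from the dual
    words on the other, each with the factor \<open>q - 1\<close>.\<close>
  ultimately have "(real q - 1) * real q ^ n = (real q - 1) * (real (card D) * real (card C))"
    using cV by simp
  then have "real q ^ n = real (card D) * real (card C)"
    using q by simp
  then have "real (card C * card D) = real (q ^ n)"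
    by simp
  then show ?thesis
    unfolding D_def q_def of_nat_eq_iff by simp
qed

lemma dual_code_dim:
  fixes C :: "'a :: {field, finite} vec set"
  assumes C: "linear_code n C"
  shows "code_dim n C + code_dim n (dual_code n C) = n"
proof -
  have "card {0, 1 :: 'a} \<le> card (UNIV :: 'a set)"
    by (intro card_mono) auto
  then have "card (UNIV :: 'a set) \<ge> 2"
    by simp
  moreover have "card (UNIV :: 'a set) ^ (code_dim n C + code_dim n (dual_code n C)) = card (UNIV :: 'a set) ^ n"
    using card_mult_card_dual[OF C] linear_code_dim[OF C]
      linear_code_dim[OF linear_code_dual] C unfolding linear_code_iff power_add by metis
  ultimately show ?thesis
    by (simp add: power_inject_exp)
qed

section \<open>Digit weights\<close>

lemma digit_weight_0 [simp]: "digit_weight q 0 h = 0"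
  by (simp add: digit_weight_def)

lemma digit_weight_Suc:
  "digit_weight q (Suc m) h = (if h mod q \<noteq> 0 then 1 else 0) + digit_weight q m (h div q)"
proof -
  have "{j. j < Suc m \<and> (h div q ^ j) mod q \<noteq> 0}
      = (if h mod q \<noteq> 0 then {0} else {}) \<union> Suc ` {j. j < m \<and> (h div q div q ^ j) mod q \<noteq> 0}"
    (is "?L = ?A \<union> ?B")
  proof (intro subset_antisym subsetI)
    fix j
    assume "j \<in> ?L"
    then show "j \<in> ?A \<union> ?B"
      by (cases j) (auto simp: div_mult2_eq)
  next
    fix j
    assume "j \<in> ?A \<union> ?B"
    then show "j \<in> ?L"
      by (auto simp: div_mult2_eq split: if_splits)
  qed
  moreover have "card (?A \<union> ?B) = card ?A + card ?B"
    by (rule card_Un_disjoint) auto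
  moreover have "card ?B = digit_weight q m (h div q)"
    by (simp add: digit_weight_def card_image)
  ultimately show ?thesis
    by (simp add: digit_weight_def)
qed

lemma digit_weight_zero [simp]: "digit_weight q m 0 = 0"
  by (simp add: digit_weight_def)

lemma digit_weight_append:
  assumes "a < q ^ k"
  shows "digit_weight q (k + m) (a + q ^ k * b) = digit_weight q k a + digit_weight q m b"
  using assms
proof (induction k arbitrary: a)
  case (Suc k)
  then have q: "q > 0"
    by (cases q) auto
  have "(a + q ^ Suc k * b) mod q = a mod q"
    by (simp add: mult.assoc)
  moreover have "(a + q ^ Suc k * b) div q = a div q + q ^ k * b"
    using q by (simp add: mult.assoc)
  moreover have "a div q < q ^ k"
    using Suc.prems q by (simp add: div_less_iff_less_mult mult.commute)
  ultimately show ?case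
    using Suc.IH[of "a div q"] by (simp add: digit_weight_Suc)
qed auto

lemma digit_weight_small:
  assumes "a < q" and "b < q" and "m \<ge> 2"
  shows "digit_weight q m (a + q * b) = (if a \<noteq> 0 then 1 else 0) + (if b \<noteq> 0 then 1 else 0)"
proof -
  obtain m' where "m = Suc (Suc m')"
    using assms(3) by (metis add_2_eq_Suc le_Suc_ex)
  then show ?thesis
    using assms by (simp add: digit_weight_Suc)
qed

text \<open>The last digit is \<open>q - j\<close> and all others are \<open>q - 1\<close>, so none
  vanishes. For \<open>j = q\<close> the last digit would be 0, which is what fixes the lower end of
  the arithmetic progression.\<close>

lemma digit_weight_pow_diff:
  assumes "1 \<le> j" and "j < q" and "k \<ge> 1"
  shows "digit_weight q k (q ^ k - j) = k"
  using assms
proof (induction k arbitrary: j)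
  case (Suc k)
  have e: "q ^ Suc k - j = (q - j) + q * (q ^ k - 1)"
    using Suc.prems by (simp add: algebra_simps)
  have "(t + q * x) mod q = t" "(t + q * x) div q = x" if "t < q" for t x
    using that by simp_all
  moreover have "q - j < q"
    using Suc.prems by simp
  ultimately have "(q ^ Suc k - j) mod q = q - j" "(q ^ Suc k - j) div q = q ^ k - 1"
    unfolding e by blast+
  moreover have "digit_weight q k (q ^ k - 1) = k"
    using Suc.IH[of 1] Suc.prems by (cases "k = 0") auto
  ultimately show ?case
    using Suc.prems by (simp add: digit_weight_Suc)
qed simp

text \<open>As \<open>q ^ m\<close> is odd, the largest odd number below it is
  \<open>q ^ m - 2\<close>, the last element of \<open>Omega\<close>. The bound
  \<open>h < q ^ m\<close> is thus exact, and it is the one natural for strings of \<open>m\<close>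
  digits.\<close>

lemma T_set_iff:
  assumes "odd q"
  shows "h \<in> T_set q m i \<longleftrightarrow> odd h \<and> h < q ^ m \<and> digit_weight q m h mod 2 = i mod 2"
proof -
  have "odd (q ^ m)"
    using assms by simp
  then obtain n where n: "q ^ m = 2 * n + 1"
    by (rule oddE)
  have "h \<in> Omega n \<longleftrightarrow> odd h \<and> h < q ^ m"
    unfolding Omega_def n by (auto elim!: oddE)
  then show ?thesis
    by (auto simp: T_set_def n)
qed

text \<open>Multiplication by \<open>q\<close> modulo \<open>q ^ m - 1\<close> is a cyclic shift of the digits.\<close>

lemma T_set_mult_q:
  assumes "odd q" and "m \<ge> 1" and h: "h \<in> T_set q m i"
  shows "q * h mod (q ^ m - 1) \<in> T_set q m i"
proof -
  obtain m' where m: "m = Suc m'"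
    using assms(2) by (cases m) auto
  have q: "q > 0"
    using assms(1) by (cases q) auto
  have h': "odd h" "h < q ^ m" "digit_weight q m h mod 2 = i mod 2"
    using h T_set_iff[OF assms(1)] by auto
  have "even (q ^ m - 1)"
    using assms(1) by simp
  define a where "a = h mod q ^ m'"
  define b where "b = h div q ^ m'"
  have hab: "h = a + q ^ m' * b"
    by (simp add: a_def b_def)
  have a: "a < q ^ m'"
    using q by (simp add: a_def)
  have b: "b < q"
    using h'(2) m q by (simp add: b_def div_less_iff_less_mult)
  have w: "digit_weight q m h = digit_weight q m' a + (if b \<noteq> 0 then 1 else 0)"
    using digit_weight_append[OF a, of 1 b] b m hab by (simp add: digit_weight_Suc)
  have w': "digit_weight q m (b + q * a) = digit_weight q m' a + (if b \<noteq> 0 then 1 else 0)"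
    using b m by (simp add: digit_weight_Suc)
  have qh: "q * h = (b + q * a) + (q ^ m - 1) * b"
  proof -
    have "q ^ m * b = (q ^ m - 1) * b + b"
      using q by (cases "q ^ m") auto
    then show ?thesis
      by (simp add: hab m algebra_simps)
  qed
  have "b + q * a \<le> (q - 1) + q * (q ^ m' - 1)"
    using a b by (intro add_mono mult_left_mono) auto
  also have "\<dots> = q ^ m - 1"
    using q by (simp add: m algebra_simps)
  finally have le: "b + q * a \<le> q ^ m - 1" .
  have "odd (q * h)"
    using assms(1) h' by simp
  then have odd: "odd (b + q * a)"
    unfolding qh using \<open>even (q ^ m - 1)\<close> by (metis even_add even_mult_iff)
  \<comment> \<open>Parity excludes the one shifted string that is not reduced, namely
    \<open>q ^ m - 1\<close> itself, with all digits \<open>q - 1\<close>.\<close>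
  then have "b + q * a < q ^ m - 1"
    using le \<open>even (q ^ m - 1)\<close> by (metis le_neq_implies_less)
  then have "q * h mod (q ^ m - 1) = b + q * a"
    unfolding qh by simp
  then show ?thesis
    using odd h'(3) w w' \<open>b + q * a < q ^ m - 1\<close> T_set_iff[OF assms(1)] by simp
qed

text \<open>The condition \<open>a ^ q = a\<close> lets \<open>a ^ h\<close> depend only on the
  digit sum of \<open>h\<close>. Each term is then a product over the digit positions, and the sum
  over all digit strings factors. It serves for \<open>a\<close> and \<open>b\<close> equal to 1 or
  -1, where it tracks the parities of \<open>h\<close> and of its weight.\<close>

lemma sum_digits_power:
  fixes a b :: real
  assumes a: "a ^ q = a" and q: "q > 0"
  shows "(\<Sum>h<q ^ m. a ^ h * b ^ digit_weight q m h) = (\<Sum>d<q. a ^ d * (if d = 0 then 1 else b)) ^ m"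
proof (induction m)
  case (Suc m)
  let ?f = "\<lambda>h. a ^ h * b ^ digit_weight q (Suc m) h"
  have s: "?f (d + h * q) = (a ^ d * (if d = 0 then 1 else b)) * (a ^ h * b ^ digit_weight q m h)" if "d < q" for d h
  proof -
    have "a ^ (h * q) = a ^ h"
      by (metis a mult.commute power_mult)
    then show ?thesis
      using that q by (simp add: digit_weight_Suc power_add)
  qed
  have "sum ?f {..<q ^ Suc m} = (\<Sum>h<q ^ m. sum ?f {h * q..<h * q + q})"
    unfolding sum.nat_group by (simp add: mult.commute)
  also have "\<dots> = (\<Sum>h<q ^ m. \<Sum>d<q. ?f (d + h * q))"
  proof (rule sum.cong[OF refl])
    fix h
    show "sum ?f {h * q..<h * q + q} = (\<Sum>d<q. ?f (d + h * q))"
      using sum.shift_bounds_nat_ivl[of ?f 0 "h * q" q] by (simp add: add.commute lessThan_atLeast0)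
  qed
  also have "\<dots> = (\<Sum>h<q ^ m. \<Sum>d<q. (a ^ d * (if d = 0 then 1 else b)) * (a ^ h * b ^ digit_weight q m h))"
    using s by (intro sum.cong) auto
  also have "\<dots> = (\<Sum>d<q. a ^ d * (if d = 0 then 1 else b)) * (\<Sum>h<q ^ m. a ^ h * b ^ digit_weight q m h)"
    by (simp add: sum_distrib_left sum_distrib_right sum.swap[of _ "{..<q}"])
  finally show ?case
    using Suc.IH by simp
qed simp

text \<open>The indicator of odd \<open>h\<close> is \<open>(1 - (-1)^h) / 2\<close>, and that of a
  given parity of the weight is \<open>(1 + (-1)^wt) / 2\<close> or
  \<open>(1 - (-1)^wt) / 2\<close>. Multiplying out leaves four of the character sums above.\<close>

lemma card_T_set:
  fixes q m :: nat
  assumes q: "odd q"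
  shows "real (card (T_set q m 0)) = (real q ^ m + (2 - real q) ^ m - 2) / 4" (is ?A)
    and "real (card (T_set q m 1)) = (real q ^ m - (2 - real q) ^ m) / 4" (is ?B)
proof -
  have q0: "q > 0"
    using q by (cases q) auto
  obtain r where r: "q = 2 * r + 1"
    using q by (elim oddE)
  have alt: "(\<Sum>d<2 * r + 1. (-1) ^ d) = (1 :: real)" for r :: nat
    by (induction r) auto
  have S1: "(\<Sum>d<q. a ^ d * (if d = 0 then 1 else b)) = 1 - b + b * (\<Sum>d<q. a ^ d)" for a b :: real
  proof -
    have "(\<Sum>d<q. a ^ d * (if d = 0 then 1 else b)) = (\<Sum>d<q. b * a ^ d + (if d = 0 then 1 - b else 0))"
      by (intro sum.cong) auto
    then show ?thesis
      using q0 by (simp add: sum.distrib sum_distrib_left)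
  qed
  let ?S = "\<lambda>(a :: real) (b :: real). \<Sum>h<q ^ m. a ^ h * b ^ digit_weight q m h"
  have 1: "?S 1 1 = real q ^ m"
    by simp
  have E: "(\<Sum>d<q. (-1) ^ d) = (1 :: real)"
    unfolding r by (rule alt)
  have m1: "(-1) ^ q = (-1 :: real)"
    using q by simp
  \<comment> \<open>The alternating sum over the \<open>q\<close> digits is 1 because
    \<open>q\<close> is odd, so the factor of one position is \<open>1 - b + b = 1\<close> for every
    \<open>b\<close>. In the fourth sum the factor is \<open>1 - (q - 1) = 2 - q\<close>.\<close>
  have 2: "?S (-1) 1 = 1" and 3: "?S (-1) (-1) = 1"
    by (simp_all only: sum_digits_power[OF m1 q0] S1 E) simp_all
  have 4: "?S 1 (-1) = (2 - real q) ^ m"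
    by (simp only: sum_digits_power[OF power_one q0] S1) simp
  have T: "T_set q m i = {h \<in> {..<q ^ m}. odd h \<and> digit_weight q m h mod 2 = i mod 2}" for i
    using T_set_iff[OF q] by auto
  have c: "real (card {h \<in> A. P h}) = (\<Sum>h\<in>A. if P h then 1 else 0)" if "finite A" for A :: "nat set" and P
    using that by (simp add: sum.If_cases Int_def)
  have "real (card (T_set q m 0)) = (\<Sum>h<q ^ m. (1 ^ h * 1 ^ digit_weight q m h - (-1) ^ h * 1 ^ digit_weight q m h
      - (-1) ^ h * (-1) ^ digit_weight q m h + 1 ^ h * (-1) ^ digit_weight q m h) / 4)"
    unfolding T c[OF finite_lessThan]
    by (intro sum.cong) (auto simp: uminus_power_if even_iff_mod_2_eq_zero)
  also have "\<dots> = (?S 1 1 - ?S (-1) 1 - ?S (-1) (-1) + ?S 1 (-1)) / 4"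
    by (simp only: sum_divide_distrib[symmetric] sum.distrib sum_subtractf)
  finally show ?A
    unfolding 1 2 3 4 by simp
  have "real (card (T_set q m 1)) = (\<Sum>h<q ^ m. (1 ^ h * 1 ^ digit_weight q m h - (-1) ^ h * 1 ^ digit_weight q m h
      + (-1) ^ h * (-1) ^ digit_weight q m h - 1 ^ h * (-1) ^ digit_weight q m h) / 4)"
    unfolding T c[OF finite_lessThan]
    by (intro sum.cong) (auto simp: uminus_power_if even_iff_mod_2_eq_zero)
  also have "\<dots> = (?S 1 1 - ?S (-1) 1 + ?S (-1) (-1) - ?S 1 (-1)) / 4"
    by (simp only: sum_divide_distrib[symmetric] sum.distrib sum_subtractf)
  finally show ?B
    unfolding 1 2 3 4 by simp
qed

text \<open>The elements are \<open>c q^(2k) + i (q^k + 1)\<close> with \<open>i = j - (q - 2)\<close>. For \<open>0 \<le> i < q^k\<close> their digit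
  blocks are \<open>i, i, c\<close>; for \<open>i = q^k\<close> they are \<open>0, 1, c + 1\<close>; a negative \<open>i\<close> borrows from both upper
  blocks, and the two lower ones then have no zero digit.\<close>

lemma arith_progression_in_T_set:
  fixes q k c m' p :: nat
  assumes q: "odd q" "q \<ge> 3" and k: "k \<ge> 1" and c: "odd c" "c + 1 < q ^ m'"
    and w: "digit_weight q m' (c - 1) mod 2 = p mod 2" "digit_weight q m' c mod 2 = p mod 2"
      "digit_weight q m' (c + 1) mod 2 = (p + 1) mod 2"
    and j: "j < q ^ k + q - 1"
  shows "(c * q ^ (2 * k) - (q - 2) * (q ^ k + 1)) + j * (q ^ k + 1) \<in> T_set q (2 * k + m') p"
proof -
  define h where "h = (c * q ^ (2 * k) - (q - 2) * (q ^ k + 1)) + j * (q ^ k + 1)"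
  have qk: "q \<le> q ^ k"
    using k q by (simp add: self_le_power)
  have c1: "c \<ge> 1"
    using c by (cases c) auto
  \<comment> \<open>This makes the subtraction of natural numbers in the first term of the
    progression exact.\<close>
  have "(q - 2) * (q ^ k + 1) \<le> q ^ k * q ^ k"
  proof -
    have "(q - 2) * (q ^ k + 1) = (q - 2) * q ^ k + (q - 2)"
      by simp
    also have "\<dots> \<le> (q - 2) * q ^ k + q ^ k"
      using qk by simp
    also have "\<dots> = (q - 2 + 1) * q ^ k"
      by simp
    also have "\<dots> \<le> q ^ k * q ^ k"
      using qk q by (intro mult_right_mono) auto
    finally show ?thesis .
  qed
  then have le: "(q - 2) * (q ^ k + 1) \<le> c * q ^ (2 * k)"
    using c1 by (metis mult_2 power_add mult_le_mono1 le_trans mult_1)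
  have three: "digit_weight q (2 * k + m') (x + q ^ k * (y + q ^ k * z))
      = digit_weight q k x + digit_weight q k y + digit_weight q m' z"
    and lt: "z < q ^ m' \<Longrightarrow> x + q ^ k * (y + q ^ k * z) < q ^ (2 * k + m')"
    if "x < q ^ k" "y < q ^ k" for x y z
  proof -
    have "digit_weight q (k + (k + m')) (x + q ^ k * (y + q ^ k * z))
      = digit_weight q k x + (digit_weight q k y + digit_weight q m' z)"
      using that by (simp add: digit_weight_append)
    then show "digit_weight q (2 * k + m') (x + q ^ k * (y + q ^ k * z))
      = digit_weight q k x + digit_weight q k y + digit_weight q m' z"
      by (simp add: mult_2 add.assoc)
    have st: "u + q ^ k * v < q ^ k * r" if "u < q ^ k" "v < r" for u v r
    proof -
      have "u + q ^ k * v < q ^ k * (v + 1)"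
        using that by simp
      also have "\<dots> \<le> q ^ k * r"
        using that by (intro mult_left_mono) auto
      finally show ?thesis .
    qed
    show "x + q ^ k * (y + q ^ k * z) < q ^ (2 * k + m')" if "z < q ^ m'"
      using st[OF \<open>x < q ^ k\<close> st[OF \<open>y < q ^ k\<close> that]] by (simp add: mult_2 power_add mult.assoc)
  qed
  \<comment> \<open>The common difference \<open>q ^ k + 1\<close> is even, so every term has the
    parity of \<open>c * q ^ (2 * k)\<close>.\<close>
  have even: "even ((q - 2) * (q ^ k + 1))" "even (j * (q ^ k + 1))"
    using q by auto
  have "odd (c * q ^ (2 * k))"
    using c q by simp
  then have "odd h"
    unfolding h_def using even le by simp
  moreover have "h < q ^ (2 * k + m') \<and> digit_weight q (2 * k + m') h mod 2 = p mod 2"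
  proof (cases "j < q - 2")
    case True
    define i where "i = q - 2 - j"
    have i: "1 \<le> i" "i + 2 \<le> q"
      using True by (auto simp: i_def)
    have "h = c * q ^ (2 * k) - i * (q ^ k + 1)"
    proof -
      have "q - 2 = i + j"
        using True by (simp add: i_def)
      then show ?thesis
        using le unfolding h_def by (simp add: add_mult_distrib)
    qed
    also have "\<dots> = (q ^ k - i) + q ^ k * ((q ^ k - (i + 1)) + q ^ k * (c - 1))"
    proof -
      have e1: "int (c * q ^ (2 * k) - i * (q ^ k + 1)) = int c * int q ^ (2 * k) - int i * (int q ^ k + 1)"
      proof -
        have "i * (q ^ k + 1) \<le> (q - 2) * (q ^ k + 1)"
          using i by (intro mult_right_mono) auto
        then have "i * (q ^ k + 1) \<le> c * q ^ (2 * k)"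
          using le by simp
        then show ?thesis
          by (simp add: of_nat_diff algebra_simps)
      qed
      have e2: "int ((q ^ k - i) + q ^ k * ((q ^ k - (i + 1)) + q ^ k * (c - 1)))
        = (int q ^ k - int i) + int q ^ k * ((int q ^ k - (int i + 1)) + int q ^ k * (int c - 1))"
        using i qk c1 by (simp add: of_nat_diff)
      have "int (c * q ^ (2 * k) - i * (q ^ k + 1)) =
        int ((q ^ k - i) + q ^ k * ((q ^ k - (i + 1)) + q ^ k * (c - 1)))"
        unfolding e1 e2 by (simp add: algebra_simps mult_2_right power_add)
      then show ?thesis
        by (simp only: of_nat_eq_iff)
    qed
    finally have h: "h = (q ^ k - i) + q ^ k * ((q ^ k - (i + 1)) + q ^ k * (c - 1))" .
    have l: "q ^ k - i < q ^ k" "q ^ k - (i + 1) < q ^ k"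
      using i q by auto
    \<comment> \<open>The middle block lends one to the lowest and thus loses \<open>i + 1\<close>.
      Since \<open>i + 1 < q\<close>, both blocks have full weight \<open>k\<close>, and together
      they contribute the even number \<open>2 * k\<close>.\<close>
    have "digit_weight q k (q ^ k - i) = k" "digit_weight q k (q ^ k - (i + 1)) = k"
      using i k by (auto intro!: digit_weight_pow_diff)
    then have "digit_weight q (2 * k + m') h = 2 * k + digit_weight q m' (c - 1)"
      unfolding h three[OF l] by simp
    then show ?thesis
      using w(1) lt[OF l, of "c - 1"] c unfolding h by simp
  next
    case False
    define i where "i = j - (q - 2)"
    have i: "i \<le> q ^ k"
      using j q by (auto simp: i_def)
    have h: "h = c * q ^ (2 * k) + i * (q ^ k + 1)"
    proof -
      have "j = (q - 2) + i"
        using False by (simp add: i_def)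
      then show ?thesis
        using le unfolding h_def by (simp add: add_mult_distrib)
    qed
    show ?thesis
    proof (cases "i = q ^ k")
      case True
      have h: "h = 0 + q ^ k * (1 + q ^ k * (c + 1))"
        unfolding h True by (simp add: algebra_simps mult_2_right power_add)
      have l: "0 < q ^ k" "1 < q ^ k"
        using q qk by auto
      have "digit_weight q k 1 = 1"
        using digit_weight_append[of 1 q 1 "k - 1" 0] k q by (simp add: digit_weight_Suc)
      \<comment> \<open>The isolated digit 1 of the middle block adds one to the weight, which is
        why \<open>c + 1\<close> is required to have the opposite parity.\<close>
      then have "digit_weight q (2 * k + m') h = 1 + digit_weight q m' (c + 1)"
        unfolding h three[OF l] by simp
      then show ?thesis
        using w(3) lt[OF l, of "c + 1"] c unfolding h by presburger
    next
      case False
      then have l: "i < q ^ k"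
        using i by simp
      have h: "h = i + q ^ k * (i + q ^ k * c)"
        unfolding h by (simp add: algebra_simps mult_2_right power_add)
      have "digit_weight q (2 * k + m') h = 2 * digit_weight q k i + digit_weight q m' c"
        unfolding h three[OF l l] by simp
      then show ?thesis
        using w(2) lt[OF l l, of c] c unfolding h by simp
    qed
  qed
  ultimately show ?thesis
    unfolding h_def[symmetric] T_set_iff[OF q(1)] by blast
qed

text \<open>Modulo \<open>d\<close>, \<open>y ^ r = -1\<close> turns \<open>y ^ (2 * r + 1) = 1\<close> into \<open>y = 1\<close>, hence \<open>1 = -1\<close>.\<close>

lemma dvd_two_of_common_divisor:
  fixes y :: int
  assumes "d dvd y ^ r + 1" and "d dvd y ^ (2 * r + 1) - 1"
  shows "d dvd 2"
proof -
  have x: "[y ^ r = -1] (mod d)"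
    using assms(1) by (simp add: cong_iff_dvd_diff)
  have "[y ^ r * y ^ r * y = (-1) * (-1) * y] (mod d)"
    by (intro cong_mult x cong_refl)
  moreover have "y ^ (2 * r + 1) = y ^ r * y ^ r * y"
    by (simp add: mult_2 power_add)
  then have "[y ^ r * y ^ r * y = 1] (mod d)"
    using assms(2) by (simp only: cong_iff_dvd_diff)
  ultimately have "[y = 1] (mod d)"
    by (metis cong_trans cong_sym mult_1 mult_minus1 minus_minus)
  then have "[y ^ r = 1] (mod d)"
    by (metis cong_pow power_one)
  then have "[1 = -1] (mod d)"
    using x by (metis cong_trans cong_sym)
  then show ?thesis
    by (simp add: cong_iff_dvd_diff)
qed

text \<open>Write \<open>q ^ m - 1 = 2 * n\<close> and \<open>q ^ (s * r) + 1 = 2 * u\<close>. If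
  \<open>c\<close> divides \<open>n\<close> and \<open>u\<close>, then \<open>2 * c\<close> divides
  both numbers and hence 2, by the preceding lemma for \<open>y = q ^ s\<close>. So \<open>n\<close>
  and \<open>u\<close> are coprime, and \<open>u\<close> can be cancelled from
  \<open>n dvd u * d\<close>.\<close>

lemma half_dvd_of_dvd_mult:
  fixes q r s d :: nat
  assumes q: "odd q" and "s * (2 * r + 1) = m" and "q ^ m - 1 dvd (q ^ (s * r) + 1) * d"
  shows "(q ^ m - 1) div 2 dvd d"
proof -
  have "even (q ^ m - 1)" "even (q ^ (s * r) + 1)"
    using q by simp_all
  then obtain n u where n: "q ^ m - 1 = 2 * n" and u: "q ^ (s * r) + 1 = 2 * u"
    by (elim evenE)
  have q1: "q ^ m \<ge> 1"
    using q by (cases q) auto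
  have "coprime n u"
  proof (rule coprimeI)
    fix c
    assume c: "c dvd n" "c dvd u"
    have "int (2 * c) dvd (int q ^ s) ^ r + 1"
    proof -
      have "int (2 * c) dvd int (q ^ (s * r) + 1)"
        unfolding u of_nat_dvd_iff using c by simp
      then show ?thesis
        by (simp add: power_mult add.commute)
    qed
    moreover have "int (2 * c) dvd (int q ^ s) ^ (2 * r + 1) - 1"
    proof -
      have "int (2 * c) dvd int (q ^ m - 1)"
        unfolding n of_nat_dvd_iff using c by simp
      also have "int (q ^ m - 1) = (int q ^ s) ^ (2 * r + 1) - 1"
        unfolding power_mult[symmetric] assms(2) using q1 by (simp add: of_nat_diff)
      finally show ?thesis .
    qed
    ultimately have "int (2 * c) dvd 2"
      by (rule dvd_two_of_common_divisor)
    then have "2 * c dvd 2 * 1"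
      by (metis int_dvd_int_iff of_nat_numeral mult.right_neutral)
    then show "is_unit c"
      using dvd_times_left_cancel_iff[of 2 c 1] by simp
  qed
  moreover have "n dvd u * d"
    using assms(3) unfolding n u by simp
  ultimately have "n dvd d"
    using coprime_dvd_mult_right_iff by blast
  then show ?thesis
    unfolding n by simp
qed

section \<open>Frobenius and the factorization of \<open>x^n + 1\<close>\<close>

lemma finite_field_power_card:
  fixes x :: "'a :: {field, finite}"
  shows "x ^ card (UNIV :: 'a set) = x"
proof (cases "x = 0")
  case True
  then show ?thesis
    by (simp add: card_gt_0_iff power_0_left)
next
  case False
  let ?U = "UNIV - {0 :: 'a}"
  have "(\<Prod>y\<in>?U. y) = (\<Prod>y\<in>?U. x * y)"
    by (rule prod.reindex_bij_witness[where i = "\<lambda>y. x * y" and j = "\<lambda>y. y / x"])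
      (use False in auto)
  also have "\<dots> = x ^ card ?U * (\<Prod>y\<in>?U. y)"
    by (simp add: prod.distrib)
  finally have "x ^ card ?U = 1"
    by simp
  moreover have "card (UNIV :: 'a set) = Suc (card ?U)"
    by (rule card.remove) simp_all
  ultimately show ?thesis
    by (simp only: power_Suc mult_1_right)
qed

lemma degree_prod_linear: "degree (\<Prod>z\<in>S. [:- z, 1 :: 'a :: field:]) = card S"
  by (simp add: degree_prod_eq_sum_degree)

lemma lead_coeff_prod_linear: "lead_coeff (\<Prod>z\<in>S. [:- z, 1 :: 'a :: field:]) = 1"
  by (simp add: lead_coeff_prod)

text \<open>Both sides are values of monic polynomials of degree \<open>q\<close> that agree on the
  \<open>q\<close> elements of the embedded ground field. In particular the fixed points of
  \<open>z ^ q\<close> are exactly these elements.\<close>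

lemma frobenius_minus_id:
  fixes \<phi> :: "'a :: {field, finite} \<Rightarrow> 'b :: field" and z :: 'b
  assumes "field_hom \<phi>"
  shows "z ^ card (UNIV :: 'a set) - z = (\<Prod>s\<in>range \<phi>. z - s)"
proof -
  interpret field_hom \<phi> by fact
  let ?q = "card (UNIV :: 'a set)"
  have cR: "card (range \<phi>) = ?q"
    using inj_f by (simp add: card_image)
  have "card {0, 1 :: 'a} \<le> ?q"
    by (intro card_mono) auto
  then have q: "?q \<ge> 2"
    by simp
  have "monom 1 ?q - [:0, 1:] = (\<Prod>s\<in>range \<phi>. [:- s, 1:])"
  proof (rule poly_eqI_degree_lead_coeff[where n = ?q and A = "range \<phi>"])
    have "degree [:0, 1 :: 'b:] < ?q"
      using q by simp
    then show "coeff (monom 1 ?q - [:0, 1:]) ?q = coeff (\<Prod>s\<in>range \<phi>. [:- s, 1:]) ?q"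
      using lead_coeff_prod_linear[of "range \<phi>"] by (simp add: coeff_eq_0 degree_prod_linear cR)
    show "degree (monom 1 ?q - [:0, 1 :: 'b:]) \<le> ?q"
      using q by (intro degree_diff_le) (auto simp: degree_monom_eq)
    fix x
    assume x: "x \<in> range \<phi>"
    then obtain a where "x = \<phi> a"
      by blast
    then have "x ^ ?q = x"
      using finite_field_power_card[of a] by (simp add: hom_power[symmetric])
    then show "poly (monom 1 ?q - [:0, 1:]) x = poly (\<Prod>s\<in>range \<phi>. [:- s, 1:]) x"
      using x by (simp add: poly_monom poly_prod prod_zero_iff)
  qed (simp_all add: cR degree_prod_linear)
  then have "poly (monom 1 ?q - [:0, 1:]) z = poly (\<Prod>s\<in>range \<phi>. [:- s, 1:]) z"
    by simp
  then show ?thesis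
    by (simp add: poly_monom poly_prod)
qed

lemma frobenius_fixed_in_range:
  fixes \<phi> :: "'a :: {field, finite} \<Rightarrow> 'b :: field" and z :: 'b
  assumes "field_hom \<phi>" and "z ^ card (UNIV :: 'a set) = z"
  shows "z \<in> range \<phi>"
proof -
  have "(\<Prod>s\<in>range \<phi>. z - s) = 0"
    using frobenius_minus_id[OF assms(1), of z] assms(2) by simp
  then show ?thesis
    by (simp add: prod_zero_iff)
qed

text \<open>Additivity: \<open>(X + y)^q\<close> and \<open>X^q + y^q\<close> are monic of degree \<open>q\<close> and agree on the \<open>q\<close>
  elements of the ground field, on whose translates \<open>X^q - X\<close> is constant.\<close>

lemma frobenius_hom:
  fixes \<phi> :: "'a :: {field, finite} \<Rightarrow> 'b :: field"
  assumes "field_hom \<phi>"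
  shows "field_hom (\<lambda>z :: 'b. z ^ card (UNIV :: 'a set))"
proof -
  interpret field_hom \<phi> by fact
  let ?q = "card (UNIV :: 'a set)"
  have cR: "card (range \<phi>) = ?q"
    using inj_f by (simp add: card_image)
  have q: "?q > 0"
    by (simp add: card_gt_0_iff)
  have shift: "(y + \<phi> s) ^ ?q = y ^ ?q + \<phi> s" for y s
  proof -
    have "(\<Prod>t\<in>range \<phi>. (y + \<phi> s) - t) = (\<Prod>t\<in>range \<phi>. y - t)"
    proof (rule prod.reindex_bij_witness[where i = "\<lambda>t. t + \<phi> s" and j = "\<lambda>t. t - \<phi> s"])
      show "t - \<phi> s \<in> range \<phi>" "t + \<phi> s \<in> range \<phi>" if "t \<in> range \<phi>" for t
        using that by (auto simp: hom_minus[symmetric] hom_add[symmetric])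
    qed auto
    then have "(y + \<phi> s) ^ ?q - (y + \<phi> s) = y ^ ?q - y"
      unfolding frobenius_minus_id[OF assms, symmetric] .
    then show ?thesis
      by (simp add: algebra_simps)
  qed
  have add: "(x + y) ^ ?q = x ^ ?q + y ^ ?q" for x y :: 'b
  proof -
    have "[:y, 1:] ^ ?q = monom 1 ?q + [:y ^ ?q:]"
    proof (rule poly_eqI_degree_lead_coeff[where n = ?q and A = "range \<phi>"])
      show "coeff ([:y, 1:] ^ ?q) ?q = coeff (monom 1 ?q + [:y ^ ?q:]) ?q"
        using q coeff_linear_power[of y ?q] by (simp add: coeff_eq_0)
      show "degree ([:y, 1:] ^ ?q) \<le> ?q"
        by (simp add: degree_linear_power)
      show "degree (monom 1 ?q + [:y ^ ?q:]) \<le> ?q"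
        by (intro degree_add_le) (auto simp: degree_monom_le)
      show "poly ([:y, 1:] ^ ?q) t = poly (monom 1 ?q + [:y ^ ?q:]) t" if "t \<in> range \<phi>" for t
      proof -
        obtain s where t: "t = \<phi> s"
          using \<open>t \<in> range \<phi>\<close> by blast
        have "t ^ ?q = t"
          unfolding t hom_power[symmetric] finite_field_power_card by (rule refl)
        then show ?thesis
          using shift[of y s] t by (simp add: poly_monom add.commute)
      qed
    qed (simp add: cR)
    then have "poly ([:y, 1:] ^ ?q) x = poly (monom 1 ?q + [:y ^ ?q:]) x"
      by simp
    then show ?thesis
      by (simp add: poly_monom add.commute)
  qed
  show ?thesis
    by unfold_locales (use q in \<open>simp_all add: add power_mult_distrib power_0_left\<close>)
qed

text \<open>The Frobenius map is injective and maps the finite set \<open>S\<close> into itself, so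
  it permutes \<open>S\<close> and fixes the coefficients of the product. Its fixed points lie in
  the range of \<open>\<phi>\<close>.\<close>

lemma prod_linear_descends:
  fixes \<phi> :: "'a :: {field, finite} \<Rightarrow> 'b :: field"
  assumes \<phi>: "field_hom \<phi>" and S: "finite S"
    and closed: "\<And>z. z \<in> S \<Longrightarrow> z ^ card (UNIV :: 'a set) \<in> S"
  shows "\<exists>g. map_poly \<phi> g = (\<Prod>z\<in>S. [:- z, 1:])"
proof -
  interpret field_hom \<phi> by fact
  let ?F = "\<lambda>z :: 'b. z ^ card (UNIV :: 'a set)"
  interpret F: field_hom ?F
    by (rule frobenius_hom[OF \<phi>])
  interpret PF: map_poly_comm_ring_hom ?F ..
  define P where "P = (\<Prod>z\<in>S. [:- z, 1:])"
  have inj: "inj_on ?F S"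
    using F.inj_f by (rule inj_on_subset) simp
  have "?F ` S = S"
    using closed S inj by (intro card_subset_eq) (auto simp: card_image)
  have "map_poly ?F P = (\<Prod>z\<in>S. map_poly ?F [:- z, 1:])"
    unfolding P_def by (rule PF.hom_prod)
  also have "\<dots> = (\<Prod>z\<in>S. [:- ?F z, 1:])"
    by (simp add: F.map_poly_pCons_hom F.hom_uminus)
  also have "\<dots> = (\<Prod>z\<in>?F ` S. [:- z, 1:])"
    using inj by (simp add: prod.reindex)
  finally have inv: "map_poly ?F P = P"
    unfolding \<open>?F ` S = S\<close> P_def .
  have "coeff P i \<in> range \<phi>" for i
  proof (rule frobenius_fixed_in_range[OF \<phi>])
    show "coeff P i ^ card (UNIV :: 'a set) = coeff P i"
      using arg_cong[OF inv, of "\<lambda>p. coeff p i"] by simp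
  qed
  then have "\<phi> (inv_into UNIV \<phi> (coeff P i)) = coeff P i" for i
    by (simp add: f_inv_into_f)
  \<comment> \<open>\<open>map_poly\<close> acts coefficientwise only for a map that sends 0 to
    0.\<close>
  moreover have "inv_into UNIV \<phi> 0 = 0"
    using inv_f_f[of 0] by simp
  ultimately have "map_poly \<phi> (map_poly (inv_into UNIV \<phi>) P) = P"
    by (intro poly_eqI) (simp add: coeff_map_poly)
  then show ?thesis
    unfolding P_def by blast
qed

text \<open>Since \<open>\<beta> ^ N = 1\<close>, the exponents below \<open>N\<close> already give
  all nonzero elements. There are \<open>N\<close> of these, so no two such exponents give the same
  power.\<close>

lemma primitive_element_power_eq_iff:
  fixes \<beta> :: "'b :: {field, finite}"
  assumes "primitive_element \<beta>"
  defines "N \<equiv> card (UNIV :: 'b set) - 1"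
  shows "\<beta> ^ i = \<beta> ^ j \<longleftrightarrow> i mod N = j mod N"
proof -
  have "card {0, 1 :: 'b} \<le> card (UNIV :: 'b set)"
    by (intro card_mono) auto
  then have N: "N > 0" "card (UNIV :: 'b set) = Suc N"
    unfolding N_def by simp_all
  have "\<beta> \<in> range (\<lambda>k. \<beta> ^ k)"
    by (rule range_eqI[of _ _ 1]) simp
  then have \<beta>: "\<beta> \<noteq> 0"
    using assms(1) unfolding primitive_element_def by auto
  then have "\<beta> ^ N = 1"
    using finite_field_power_card[of \<beta>] N by simp
  then have red: "\<beta> ^ k = \<beta> ^ (k mod N)" for k
    by (metis div_mult_mod_eq mult.commute mult_1 power_add power_mult power_one)
  have "(\<lambda>k. \<beta> ^ k) ` {..<N} = UNIV - {0}"
  proof -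
    have "(\<lambda>k. \<beta> ^ k) ` {..<N} = range (\<lambda>k. \<beta> ^ k)"
      using red N by (auto simp: image_iff) (metis lessThan_iff mod_less_divisor)
    then show ?thesis
      using assms(1) unfolding primitive_element_def by simp
  qed
  then have "card ((\<lambda>k. \<beta> ^ k) ` {..<N}) = card {..<N}"
    using N by simp
  then have inj: "inj_on (\<lambda>k. \<beta> ^ k) {..<N}"
    by (intro eq_card_imp_inj_on) auto
  have "\<beta> ^ i = \<beta> ^ j \<longleftrightarrow> \<beta> ^ (i mod N) = \<beta> ^ (j mod N)"
    using red by metis
  also have "\<dots> \<longleftrightarrow> i mod N = j mod N"
    using inj N by (auto simp: inj_on_def)
  finally show ?thesis .
qed

lemma finite_Omega: "finite (Omega n)" and card_Omega: "card (Omega n) = n"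
proof -
  have "Omega n = (\<lambda>i. 1 + 2 * i) ` {..<n}"
    by (auto simp: Omega_def)
  then show "finite (Omega n)" "card (Omega n) = n"
    by (auto simp: card_image inj_on_def)
qed

lemma primitive_element_inj_Omega:
  fixes \<beta> :: "'b :: {field, finite}"
  assumes \<beta>: "primitive_element \<beta>" and n: "card (UNIV :: 'b set) = 2 * n + 1"
  shows "inj_on (\<lambda>i. \<beta> ^ i) (Omega n)"
proof (rule inj_onI)
  fix i j
  assume "i \<in> Omega n" "j \<in> Omega n" "\<beta> ^ i = \<beta> ^ j"
  then show "i = j"
    using n by (auto simp: primitive_element_power_eq_iff[OF \<beta>] Omega_def)
qed

lemma primitive_element_half_power:
  fixes \<beta> :: "'b :: {field, finite}"
  assumes \<beta>: "primitive_element \<beta>" and n: "card (UNIV :: 'b set) = 2 * n + 1"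
  shows "\<beta> ^ n = -1"
proof -
  have "card {0, 1 :: 'b} \<le> card (UNIV :: 'b set)"
    by (intro card_mono) auto
  then have n0: "n > 0"
    using n by simp
  have "\<beta> ^ n \<noteq> \<beta> ^ 0" "\<beta> ^ (n * 2) = \<beta> ^ 0"
    unfolding primitive_element_power_eq_iff[OF \<beta>] n using n0 by (simp_all add: mult.commute)
  then have "(\<beta> ^ n)\<^sup>2 = 1" "\<beta> ^ n \<noteq> 1"
    by (simp_all add: power_mult)
  then show ?thesis
    by (simp add: power2_eq_1_iff)
qed

text \<open>Two monic polynomials of degree \<open>n\<close> agree at the \<open>n\<close> distinct
  points \<open>\<beta> ^ i\<close>: at each of them \<open>x ^ n\<close> is an odd power of
  \<open>\<beta> ^ n = -1\<close>.\<close>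

lemma prod_Omega:
  fixes \<beta> :: "'b :: {field, finite}"
  assumes \<beta>: "primitive_element \<beta>" and n: "card (UNIV :: 'b set) = 2 * n + 1"
  shows "(\<Prod>i\<in>Omega n. [:- (\<beta> ^ i), 1:]) = monom 1 n + 1"
proof -
  note inj = primitive_element_inj_Omega[OF \<beta> n]
  have "card {0, 1 :: 'b} \<le> card (UNIV :: 'b set)"
    by (intro card_mono) auto
  then have n0: "n > 0"
    using n by simp
  let ?S = "(\<lambda>i. \<beta> ^ i) ` Omega n"
  have cS: "card ?S = n"
    using inj by (simp add: card_image card_Omega)
  have "(\<Prod>z\<in>?S. [:- z, 1:]) = monom 1 n + 1"
  proof (rule poly_eqI_degree_lead_coeff[where n = n and A = ?S])
    show "coeff (\<Prod>z\<in>?S. [:- z, 1:]) n = coeff (monom 1 n + 1) n"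
      using lead_coeff_prod_linear[of ?S] n0 by (simp add: degree_prod_linear cS coeff_eq_0)
    show "degree (monom 1 n + 1 :: 'b poly) \<le> n"
      by (intro degree_add_le) (auto simp: degree_monom_le)
    fix x
    assume x: "x \<in> ?S"
    then obtain i where "x = \<beta> ^ (1 + 2 * i)"
      unfolding Omega_def by blast
    then have "x ^ n = (\<beta> ^ n) ^ (1 + 2 * i)"
      by (simp only: power_mult[symmetric] mult.commute)
    then have "x ^ n = -1"
      by (simp add: primitive_element_half_power[OF \<beta> n])
    then show "poly (\<Prod>z\<in>?S. [:- z, 1:]) x = poly (monom 1 n + 1) x"
      using x finite_Omega by (simp add: poly_monom poly_prod prod_zero_iff)
  qed (simp_all add: degree_prod_linear cS)
  then show ?thesis
    using inj by (simp add: prod.reindex)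
qed

section \<open>Zeros of negacyclic codes\<close>

lemma coeff_poly_of_word: "coeff (poly_of_word c) i = (if i < dim_vec c then c $ i else 0)"
  unfolding poly_of_word_def by (simp add: nth_default_def list_of_vec_index)

lemma degree_monom_plus_one: "n > 0 \<Longrightarrow> degree (monom 1 n + 1 :: 'a :: field poly) = n"
  by (subst degree_add_eq_left) (simp_all add: degree_monom_eq)

lemma coeff_mod_monom_plus_one:
  assumes "n > 0" and "i \<ge> n"
  shows "coeff (p mod (monom 1 n + 1 :: 'a :: field poly)) i = 0"
proof -
  have "degree (monom 1 n + 1 :: 'a poly) > 0"
    using assms by (simp add: degree_monom_plus_one)
  then have "degree (p mod (monom 1 n + 1)) < n"
    using degree_mod_less'[of "monom 1 n + 1" p] assms(1) degree_monom_plus_one[of n, where ?'a = 'a]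
    by (cases "p mod (monom 1 n + 1) = 0") fastforce+
  then show ?thesis
    using assms(2) by (simp add: coeff_eq_0)
qed

lemma mod_monom_plus_one_id:
  assumes "n > 0" and "\<And>i. i \<ge> n \<Longrightarrow> coeff p i = 0"
  shows "p mod (monom 1 n + 1 :: 'a :: field poly) = p"
proof -
  have "degree p < n"
    using assms by (metis degree_0 leading_coeff_neq_0 not_le)
  then show ?thesis
    by (intro mod_poly_less) (simp add: degree_monom_plus_one assms)
qed

lemma word_of_poly_carrier [simp]: "word_of_poly n p \<in> carrier_vec n"
  by (simp add: word_of_poly_def)

lemma poly_of_word_of_poly:
  "n > 0 \<Longrightarrow> poly_of_word (word_of_poly n p) = p mod (monom 1 n + 1)"
  by (rule poly_eqI) (simp add: coeff_poly_of_word word_of_poly_def coeff_mod_monom_plus_one)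

lemma word_of_poly_index:
  assumes "i < n" and "\<And>i. i \<ge> n \<Longrightarrow> coeff p i = 0"
  shows "word_of_poly n p $ i = coeff p i"
  using assms mod_monom_plus_one_id[of n p] by (simp add: word_of_poly_def)

lemma word_of_poly_add: "word_of_poly n (p + r) = word_of_poly n p + word_of_poly n r"
  by (rule eq_vecI) (simp_all add: word_of_poly_def poly_mod_add_left)

lemma word_of_poly_smult: "word_of_poly n (Polynomial.smult a p) = a \<cdot>\<^sub>v word_of_poly n p"
  by (rule eq_vecI) (simp_all add: word_of_poly_def mod_smult_left)

lemma word_of_poly_mod: "word_of_poly n (p mod (monom 1 n + 1)) = word_of_poly n p"
  by (simp add: word_of_poly_def)

lemma negacyclic_code_range:
  assumes "n > 0"
  shows "negacyclic_code n (range (\<lambda>a. word_of_poly n (a * g)))"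
proof -
  have "0\<^sub>v n = word_of_poly n (0 * g)"
    by (rule eq_vecI) (simp_all add: word_of_poly_def)
  then have zero: "0\<^sub>v n \<in> range (\<lambda>a. word_of_poly n (a * g))"
    by blast
  have add: "word_of_poly n (a * g) + word_of_poly n (b * g) \<in> range (\<lambda>a. word_of_poly n (a * g))" for a b
    by (rule range_eqI[of _ _ "a + b"]) (simp add: word_of_poly_add[symmetric] algebra_simps)
  have smult: "c \<cdot>\<^sub>v word_of_poly n (a * g) \<in> range (\<lambda>a. word_of_poly n (a * g))" for a c
    by (rule range_eqI[of _ _ "Polynomial.smult c a"]) (simp add: word_of_poly_smult[symmetric])
  have mult: "word_of_poly n (b * poly_of_word (word_of_poly n (a * g))) \<in> range (\<lambda>a. word_of_poly n (a * g))" for a b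
  proof (rule range_eqI[of _ _ "b * a"])
    have "word_of_poly n (b * poly_of_word (word_of_poly n (a * g)))
        = word_of_poly n ((b * ((a * g) mod (monom 1 n + 1))) mod (monom 1 n + 1))"
      using assms by (simp add: poly_of_word_of_poly word_of_poly_mod)
    also have "\<dots> = word_of_poly n (b * a * g)"
      by (simp only: mod_mult_right_eq word_of_poly_mod mult.assoc)
    finally show "word_of_poly n (b * poly_of_word (word_of_poly n (a * g))) = word_of_poly n (b * a * g)" .
  qed
  show ?thesis
    unfolding negacyclic_code_def linear_code_iff using zero add smult mult by auto
qed

text \<open>Encoding by \<open>u * g\<close> with \<open>u\<close> of degree below
  \<open>n - degree g\<close> is a bijection. It is injective because these products need no
  reduction modulo \<open>x^n + 1\<close>, and surjective because a reduced multiple of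
  \<open>g\<close> is still a multiple of \<open>g\<close>, as \<open>g\<close> divides the
  modulus.\<close>

lemma card_code_of_generator:
  fixes g :: "'a :: {field, finite} poly"
  assumes n: "n > 0" and g: "g dvd monom 1 n + 1"
  shows "card (range (\<lambda>a. word_of_poly n (a * g))) = card (UNIV :: 'a set) ^ (n - degree g)"
proof -
  let ?f = "monom 1 n + 1 :: 'a poly"
  let ?k = "n - degree g"
  have f0: "?f \<noteq> 0"
    using degree_monom_plus_one[OF n, where ?'a = 'a] n by auto
  then have g0: "g \<noteq> 0"
    using g by auto
  have dg: "degree g \<le> n"
    using dvd_imp_degree_le[OF g f0] degree_monom_plus_one[OF n, where ?'a = 'a] by simp
  have small: "coeff (poly_of_word u * g) i = 0" if u: "u \<in> carrier_vec ?k" and i: "i \<ge> n" for u i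
  proof (cases "poly_of_word u = 0")
    case False
    have "coeff (poly_of_word u) (degree (poly_of_word u)) \<noteq> 0"
      using False by simp
    then have "degree (poly_of_word u) < ?k"
      using u unfolding coeff_poly_of_word by (auto split: if_splits)
    then have "degree (poly_of_word u * g) < n"
      using degree_mult_le[of "poly_of_word u" g] by simp
    then show ?thesis
      using i by (simp add: coeff_eq_0)
  qed simp
  let ?F = "\<lambda>u. word_of_poly n (poly_of_word u * g)"
  have "inj_on ?F (carrier_vec ?k)"
  proof (rule inj_onI)
    fix u v :: "'a vec"
    assume u: "u \<in> carrier_vec ?k" and v: "v \<in> carrier_vec ?k" and "?F u = ?F v"
    then have "poly_of_word (?F u) = poly_of_word (?F v)"
      by simp
    then have "poly_of_word u * g = poly_of_word v * g"
      unfolding poly_of_word_of_poly[OF n] using mod_monom_plus_one_id[OF n small[OF u]]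
        mod_monom_plus_one_id[OF n small[OF v]] by simp
    then have eq: "poly_of_word u = poly_of_word v"
      using g0 by simp
    show "u = v"
    proof (rule eq_vecI)
      fix i
      assume "i < dim_vec v"
      then show "u $ i = v $ i"
        using arg_cong[OF eq, of "\<lambda>p. coeff p i"] u v by (simp add: coeff_poly_of_word)
    qed (use u v in simp)
  qed
  moreover have "?F ` carrier_vec ?k = range (\<lambda>a. word_of_poly n (a * g))"
  proof (intro equalityI subsetI)
    fix w
    assume "w \<in> range (\<lambda>a. word_of_poly n (a * g))"
    then obtain a where w: "w = word_of_poly n (a * g)"
      by blast
    have "g dvd (a * g) mod ?f"
      using g by (simp add: dvd_mod)
    then obtain b where b: "(a * g) mod ?f = b * g"
      by (metis dvdE mult.commute)
    have "coeff b i = 0" if i: "i \<ge> ?k" for i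
    proof (rule ccontr)
      assume "coeff b i \<noteq> 0"
      then have "i \<le> degree b" "b \<noteq> 0"
        by (auto intro: le_degree)
      then have "degree (b * g) \<ge> n"
        using i dg g0 by (simp add: degree_mult_eq)
      moreover have "b * g \<noteq> 0"
        using \<open>b \<noteq> 0\<close> g0 by simp
      ultimately show False
        using coeff_mod_monom_plus_one[OF n, of "degree (b * g)" "a * g"] unfolding b
        by (metis leading_coeff_0_iff)
    qed
    then have "poly_of_word (vec ?k (coeff b)) = b"
      by (intro poly_eqI) (simp add: coeff_poly_of_word)
    then have "w = ?F (vec ?k (coeff b))"
      unfolding w by (metis b word_of_poly_mod)
    then show "w \<in> ?F ` carrier_vec ?k"
      by (metis image_eqI vec_carrier)
  qed auto
  ultimately show ?thesis
    using card_carrier_vec[of ?k, where ?'a = 'a] by (metis card_image)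
qed

lemma poly_eq_sum_coeff:
  fixes p :: "'a :: comm_semiring_1 poly"
  assumes "\<And>i. i \<ge> n \<Longrightarrow> coeff p i = 0"
  shows "poly p x = (\<Sum>i<n. coeff p i * x ^ i)"
proof -
  have "poly p x = (\<Sum>i\<le>degree p. coeff p i * x ^ i)"
    by (rule poly_altdef)
  also have "\<dots> = (\<Sum>i\<in>{..degree p} \<union> {..<n}. coeff p i * x ^ i)"
    by (rule sum.mono_neutral_left) (auto simp: coeff_eq_0)
  also have "\<dots> = (\<Sum>i<n. coeff p i * x ^ i)"
    using assms by (intro sum.mono_neutral_right) auto
  finally show ?thesis .
qed

lemma zeros_of_code:
  fixes \<phi> :: "'a :: field \<Rightarrow> 'b :: field"
  assumes \<phi>: "field_hom \<phi>" and n: "n > 0" and g: "g dvd monom 1 n + 1"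
    and z: "poly (map_poly \<phi> g) z = 0" and c: "c \<in> range (\<lambda>a. word_of_poly n (a * g))"
  shows "(\<Sum>j<n. \<phi> (c $ j) * z ^ j) = 0"
proof -
  interpret field_hom \<phi> by fact
  interpret P: map_poly_comm_ring_hom \<phi> ..
  obtain a where a: "c = word_of_poly n (a * g)"
    using c by blast
  have "g dvd poly_of_word c"
    using g unfolding a poly_of_word_of_poly[OF n] by (simp add: dvd_mod)
  then have "map_poly \<phi> g dvd map_poly \<phi> (poly_of_word c)"
    by (rule P.hom_dvd)
  then have "poly (map_poly \<phi> (poly_of_word c)) z = 0"
    using z by (auto elim: dvdE)
  moreover have "poly (map_poly \<phi> (poly_of_word c)) z = (\<Sum>j<n. \<phi> (c $ j) * z ^ j)"
  proof -
    have "dim_vec c = n"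
      by (simp add: a word_of_poly_def)
    then show ?thesis
      by (subst poly_eq_sum_coeff[where n = n]) (simp_all add: coeff_poly_of_word)
  qed
  ultimately show ?thesis
    by simp
qed

text \<open>The quotient \<open>h = (x^n + 1) / (x - w)\<close> is a multiple of the generator polynomial, and the
  coefficient of \<open>x^j\<close> in it is proportional to \<open>w^(-j)\<close>.\<close>

lemma zeros_of_dual_code:
  fixes \<phi> :: "'a :: field \<Rightarrow> 'b :: field"
  assumes \<phi>: "field_hom \<phi>" and n: "n > 0" and w: "w \<noteq> 0"
    and h: "[:- w, 1:] * h = monom 1 n + 1" and dvd: "map_poly \<phi> g dvd h"
    and y: "y \<in> dual_code n (range (\<lambda>a. word_of_poly n (a * g)))"
  shows "(\<Sum>j<n. \<phi> (y $ j) * (1 / w) ^ j) = 0"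
proof -
  interpret field_hom \<phi> by fact
  interpret P: map_poly_comm_ring_hom \<phi> ..
  define G where "G = map_poly \<phi> g"
  define L where "L p = (\<Sum>j<n. \<phi> (y $ j) * coeff p j)" for p
  have yn: "dim_vec y = n"
    using y by (simp add: dual_code_iff carrier_vecD)
  have L_sum: "L (sum p A) = (\<Sum>t\<in>A. L (p t))" for p and A :: "nat set"
    unfolding L_def coeff_sum sum_distrib_left by (rule sum.swap)
  have L_smult: "L (Polynomial.smult c p) = c * L p" for c p
    by (simp add: L_def sum_distrib_left mult.left_commute)
  have h0: "h \<noteq> 0"
    using h degree_monom_plus_one[OF n, where ?'a = 'b] n by auto
  have "degree ([:- w, 1:] * h) = degree [:- w, 1:] + degree h"
    by (rule degree_mult_eq) (use h0 in simp_all)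
  then have dh: "degree h < n"
    unfolding h degree_monom_plus_one[OF n] by simp
  obtain a where a: "h = a * G"
    using dvd unfolding G_def by (metis dvdE mult.commute)
  \<comment> \<open>\<open>L\<close> extends the inner product with \<open>y\<close> to polynomials
    over the larger field. The cofactor \<open>a\<close> need not come from the ground field, so
    \<open>h\<close> is treated as a combination of shifts \<open>x^t * g\<close>. Their degree is
    at most \<open>degree h < n\<close>, so they are codewords without reduction.\<close>
  have "L (monom 1 t * G) = 0" if t: "t \<le> degree a" for t
  proof -
    have "degree (monom 1 t * g) \<le> t + degree g"
      using degree_mult_le[of "monom 1 t" g] degree_monom_le[of "1 :: 'a" t] by simp
    also have "\<dots> \<le> degree h"
      using t h0 unfolding a by (simp add: degree_mult_eq G_def)
    finally have "degree (monom 1 t * g) < n"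
      using dh by simp
    then have sm: "coeff (monom 1 t * g) i = 0" if "i \<ge> n" for i
      using that by (intro coeff_eq_0) simp
    have "y \<bullet> word_of_poly n (monom 1 t * g) = 0"
      using y unfolding dual_code_iff by blast
    also have "y \<bullet> word_of_poly n (monom 1 t * g) = (\<Sum>j<n. y $ j * coeff (monom 1 t * g) j)"
      using word_of_poly_index[of _ n "monom 1 t * g"] sm
      by (simp add: scalar_prod_def word_of_poly_def atLeast0LessThan)
    finally have "\<phi> (\<Sum>j<n. y $ j * coeff (monom 1 t * g) j) = 0"
      by simp
    moreover have "monom 1 t * G = map_poly \<phi> (monom 1 t * g)"
      unfolding G_def by (simp add: P.hom_mult)
    ultimately show ?thesis
      by (simp add: L_def hom_sum hom_mult)
  qed
  moreover have "h = (\<Sum>t\<le>degree a. Polynomial.smult (coeff a t) (monom 1 t * G))"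
  proof -
    have "h = (\<Sum>t\<le>degree a. monom (coeff a t) t) * G"
      by (simp add: a poly_as_sum_of_monoms)
    also have "\<dots> = (\<Sum>t\<le>degree a. Polynomial.smult (coeff a t) (monom 1 t * G))"
      unfolding sum_distrib_right by (simp add: mult_smult_left[symmetric] smult_monom)
    finally show ?thesis .
  qed
  ultimately have Lh: "L h = 0"
    by (simp add: L_sum L_smult)
  \<comment> \<open>Below \<open>x^n\<close> the product \<open>(x - w) * h\<close> has only its
    constant term, so consecutive coefficients of \<open>h\<close> differ by the factor
    \<open>1 / w\<close>.\<close>
  have rec: "coeff h j = coeff h 0 * (1 / w) ^ j" if "j < n" for j
    using that
  proof (induction j)
    case (Suc j)
    have "coeff ([:- w, 1:] * h) (Suc j) = coeff (monom 1 n + 1) (Suc j)"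
      unfolding h ..
    then have "coeff h j = w * coeff h (Suc j)"
      using Suc.prems by (simp add: coeff_pCons)
    then show ?case
      using Suc w by (simp add: field_simps)
  qed simp
  have "coeff ([:- w, 1:] * h) 0 = 1"
    unfolding h using n by simp
  then have c0: "coeff h 0 \<noteq> 0"
    by auto
  have "L h = coeff h 0 * (\<Sum>j<n. \<phi> (y $ j) * (1 / w) ^ j)"
    unfolding L_def sum_distrib_left
  proof (rule sum.cong[OF refl])
    fix j
    assume "j \<in> {..<n}"
    then have "coeff h j = coeff h 0 * (1 / w) ^ j"
      by (intro rec) simp
    then show "\<phi> (y $ j) * coeff h j = coeff h 0 * (\<phi> (y $ j) * (1 / w) ^ j)"
      by (simp only: mult.left_commute)
  qed
  then show ?thesis
    using Lh c0 by simp
qed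

text \<open>The Vandermonde argument: test the vanishing power sums against the polynomial of degree less
  than \<open>d\<close> that vanishes at all locators but one.\<close>

lemma bch_bound:
  fixes \<alpha> \<gamma> :: "'b :: field"
  assumes zeros: "\<And>i. i < d \<Longrightarrow> (\<Sum>j<n. c j * (\<gamma> * \<alpha> ^ i) ^ j) = 0"
    and inj: "inj_on (\<lambda>j. \<alpha> ^ j) {..<n}" and \<gamma>: "\<gamma> \<noteq> 0" and c: "j0 < n" "c j0 \<noteq> 0"
  shows "d + 1 \<le> card {j. j < n \<and> c j \<noteq> 0}"
proof (rule ccontr)
  let ?S = "{j. j < n \<and> c j \<noteq> 0}"
  assume "\<not> d + 1 \<le> card ?S"
  then have d: "card ?S \<le> d"
    by simp
  have S: "finite ?S" "j0 \<in> ?S"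
    using c by auto
  define P where "P = (\<Prod>j\<in>?S - {j0}. [:- (\<alpha> ^ j), 1:])"
  have "degree P = card (?S - {j0})"
    unfolding P_def by (simp add: degree_prod_eq_sum_degree)
  moreover have "card (?S - {j0}) < card ?S"
    using S by (intro psubset_card_mono) auto
  \<comment> \<open>Leaving out the locator of \<open>j0\<close> lowers the degree by one, so that
    only the \<open>d\<close> power sums known to vanish are needed.\<close>
  ultimately have dP: "degree P < d"
    using d by simp
  have "(\<Sum>j<n. c j * \<gamma> ^ j * poly P (\<alpha> ^ j)) = (\<Sum>j<n. \<Sum>i\<le>degree P. coeff P i * (c j * (\<gamma> * \<alpha> ^ i) ^ j))"
    by (simp add: poly_altdef sum_distrib_left power_mult_distrib power_mult[symmetric] mult_ac)
  also have "\<dots> = (\<Sum>i\<le>degree P. coeff P i * (\<Sum>j<n. c j * (\<gamma> * \<alpha> ^ i) ^ j))"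
    unfolding sum_distrib_left by (rule sum.swap)
  also have "\<dots> = 0"
    using zeros dP by simp
  finally have "(\<Sum>j<n. c j * \<gamma> ^ j * poly P (\<alpha> ^ j)) = 0" .
  moreover have "(\<Sum>j<n. c j * \<gamma> ^ j * poly P (\<alpha> ^ j)) = (\<Sum>j\<in>{j0}. c j * \<gamma> ^ j * poly P (\<alpha> ^ j))"
  proof (rule sum.mono_neutral_right)
    show "\<forall>j\<in>{..<n} - {j0}. c j * \<gamma> ^ j * poly P (\<alpha> ^ j) = 0"
    proof
      fix j
      assume j: "j \<in> {..<n} - {j0}"
      show "c j * \<gamma> ^ j * poly P (\<alpha> ^ j) = 0"
      proof (cases "c j = 0")
        case False
        then have "j \<in> ?S - {j0}"
          using j by simp
        then have "poly P (\<alpha> ^ j) = 0"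
          unfolding P_def poly_prod using S by (intro prod_zero) auto
        then show ?thesis
          by simp
      qed simp
    qed
  qed (use c in auto)
  ultimately have "poly P (\<alpha> ^ j0) = 0"
    using c \<gamma> by simp
  then obtain j where "j \<in> ?S - {j0}" "\<alpha> ^ j0 = \<alpha> ^ j"
    unfolding P_def poly_prod using S by (auto simp: prod_zero_iff)
  then show False
    using inj c by (auto simp: inj_on_def)
qed

section \<open>The codes defined by the parity of the digit weight\<close>

text \<open>These are the locators of the BCH bound, which must differ at all \<open>n\<close>
  positions. Equality of two of them makes \<open>n\<close> divide the difference of two exponents
  below \<open>n\<close>.\<close>

lemma inj_on_primitive_element_power:
  fixes \<beta> :: "'b :: {field, finite}"
  assumes \<beta>: "primitive_element \<beta>" and card: "card (UNIV :: 'b set) = q ^ m"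
    and q: "odd q" and m: "s * (2 * r + 1) = m"
  shows "inj_on (\<lambda>j. (\<beta> ^ (q ^ (s * r) + 1)) ^ j) {..<(q ^ m - 1) div 2}"
proof (rule linorder_inj_onI)
  fix i j
  assume ij: "i < j" "i \<in> {..<(q ^ m - 1) div 2}" "j \<in> {..<(q ^ m - 1) div 2}"
  let ?u = "q ^ (s * r) + 1"
  show "(\<beta> ^ ?u) ^ i \<noteq> (\<beta> ^ ?u) ^ j"
  proof
    assume "(\<beta> ^ ?u) ^ i = (\<beta> ^ ?u) ^ j"
    then have "\<beta> ^ (?u * i) = \<beta> ^ (?u * j)"
      by (simp only: power_mult)
    then have "?u * j mod (q ^ m - 1) = ?u * i mod (q ^ m - 1)"
      unfolding primitive_element_power_eq_iff[OF \<beta>] card by (rule sym)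
    moreover have "?u * i \<le> ?u * j"
      using ij by (intro mult_left_mono) auto
    ultimately have "q ^ m - 1 dvd ?u * j - ?u * i"
      using mod_eq_dvd_iff_nat by blast
    then have "q ^ m - 1 dvd ?u * (j - i)"
      by (simp only: diff_mult_distrib2)
    then have "(q ^ m - 1) div 2 dvd j - i"
      by (rule half_dvd_of_dvd_mult[OF q m])
    then have "(q ^ m - 1) div 2 \<le> j - i"
      using ij by (intro dvd_imp_le) auto
    then show False
      using ij by simp
  qed
qed auto

text \<open>The parity of the weight has to change from \<open>c\<close> to \<open>c + 1\<close> but
  not from \<open>c - 1\<close> to \<open>c\<close>. For \<open>c = q\<close> a second nonzero digit
  appears, with weights 1, 1, 2; for \<open>c = 2 * q - 1\<close> a carry removes one, with weights
  2, 2, 1. Both values are odd, and two digits suffice for them, whence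
  \<open>s \<ge> 2\<close>.\<close>

lemma T_set_progression:
  fixes q s k :: nat
  assumes q: "odd q" "q \<ge> 5" and k: "k \<ge> 1" and s: "s \<ge> 2"
  shows "\<exists>b. \<forall>j < q ^ k + q - 1. b + j * (q ^ k + 1) \<in> T_set q (2 * k + s) 1"
    and "\<exists>b. \<forall>j < q ^ k + q - 1. b + j * (q ^ k + 1) \<in> T_set q (2 * k + s) 0"
proof -
  have "2 * q < q * q"
    using q by simp
  also have "\<dots> \<le> q ^ s"
    using power_increasing[OF s, of q] q by (simp add: power2_eq_square)
  finally have "2 * q < q ^ s" .
  note w = digit_weight_small[where q = q and m = s]
  have "digit_weight q s (q - 1) = 1"
    using w[of "q - 1" 0] q s by simp
  moreover have "digit_weight q s q = 1"
    using w[of 0 1] q s by simp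
  moreover have "digit_weight q s (q + 1) = 2"
    using w[of 1 1] q s by simp
  ultimately have "\<forall>j < q ^ k + q - 1.
      (q * q ^ (2 * k) - (q - 2) * (q ^ k + 1)) + j * (q ^ k + 1) \<in> T_set q (2 * k + s) 1"
    using arith_progression_in_T_set[of q k q s 1] q k \<open>2 * q < q ^ s\<close> by simp
  then show "\<exists>b. \<forall>j < q ^ k + q - 1. b + j * (q ^ k + 1) \<in> T_set q (2 * k + s) 1"
    by blast
  have e: "2 * q - 1 - 1 = q - 2 + q * 1" "2 * q - 1 = q - 1 + q * 1" "2 * q - 1 + 1 = 0 + q * 2"
    using q by simp_all
  have "digit_weight q s (2 * q - 1 - 1) = 2"
    unfolding e(1) using w[of "q - 2" 1] q s by simp
  moreover have "digit_weight q s (2 * q - 1) = 2"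
    unfolding e(2) using w[of "q - 1" 1] q s by simp
  moreover have "digit_weight q s (2 * q - 1 + 1) = 1"
    unfolding e(3) using w[of 0 2] q s by simp
  moreover have "odd (2 * q - 1)"
    using q by simp
  ultimately have "\<forall>j < q ^ k + q - 1.
      ((2 * q - 1) * q ^ (2 * k) - (q - 2) * (q ^ k + 1)) + j * (q ^ k + 1) \<in> T_set q (2 * k + s) 0"
    using arith_progression_in_T_set[of q k "2 * q - 1" s 0] q k \<open>2 * q < q ^ s\<close> by simp
  then show "\<exists>b. \<forall>j < q ^ k + q - 1. b + j * (q ^ k + 1) \<in> T_set q (2 * k + s) 0"
    by blast
qed

text \<open>This covers both codes: \<open>\<eta>\<close> is \<open>\<beta>\<close> for the code
  itself and \<open>1 / \<beta>\<close> for its dual.\<close>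

lemma min_dist_of_zeros:
  fixes \<phi> :: "'a :: field \<Rightarrow> 'b :: field"
  assumes \<phi>: "field_hom \<phi>" and C: "linear_code n C" "card C > 1"
    and \<eta>: "\<eta> \<noteq> 0" and inj: "inj_on (\<lambda>j. (\<eta> ^ u) ^ j) {..<n}"
    and zeros: "\<And>c i. c \<in> C \<Longrightarrow> i < d \<Longrightarrow> (\<Sum>j<n. \<phi> (c $ j) * (\<eta> ^ (b + i * u)) ^ j) = 0"
  shows "d + 1 \<le> min_dist C"
proof (rule min_dist_ge[OF C])
  interpret field_hom \<phi> by fact
  fix c
  assume c: "c \<in> C" "c \<noteq> 0\<^sub>v n"
  have "c \<in> carrier_vec n"
    using c C unfolding linear_code_iff by auto
  then obtain j0 where j0: "j0 < n" "c $ j0 \<noteq> 0"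
    using c(2) by (metis carrier_vecD eq_vecI index_zero_vec(1) index_zero_vec(2))
  have "d + 1 \<le> card {j. j < n \<and> \<phi> (c $ j) \<noteq> 0}"
  proof (rule bch_bound[where \<gamma> = "\<eta> ^ b" and \<alpha> = "\<eta> ^ u"])
    fix i
    assume "i < d"
    then show "(\<Sum>j<n. \<phi> (c $ j) * (\<eta> ^ b * (\<eta> ^ u) ^ i) ^ j) = 0"
      using zeros[OF c(1)] by (simp add: power_add power_mult[symmetric] mult.commute)
  qed (use inj \<eta> j0 in auto)
  then show "d + 1 \<le> card {j. j < n \<and> c $ j \<noteq> 0}"
    by simp
qed

lemma T_set_subset_Omega: "T_set q m i \<subseteq> Omega ((q ^ m - 1) div 2)"
  by (auto simp: T_set_def)

text \<open>Closure under multiplication by \<open>q\<close> makes the root set stable under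
  Frobenius, so the product of linear factors comes from a \<open>g\<close> over the ground field.
  Injectivity of \<open>map_poly \<phi>\<close> makes this \<open>g\<close> unique, which resolves
  the definite description.\<close>

lemma code_of_defining_set_eq:
  fixes \<phi> :: "'a :: {field, finite} \<Rightarrow> 'b :: {field, finite}"
  assumes \<phi>: "field_hom \<phi>" and \<beta>: "primitive_element \<beta>" and n: "card (UNIV :: 'b set) = 2 * n + 1"
    and Z: "Z \<subseteq> Omega n"
    and closed: "\<And>i. i \<in> Z \<Longrightarrow> card (UNIV :: 'a set) * i mod (2 * n) \<in> Z"
  obtains g where "map_poly \<phi> g = (\<Prod>i\<in>Z. [:- (\<beta> ^ i), 1:])" and "g dvd monom 1 n + 1"
    and "degree g = card Z" and "code_of_defining_set \<phi> \<beta> n Z = range (\<lambda>a. word_of_poly n (a * g))"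
    and "negacyclic_code n (code_of_defining_set \<phi> \<beta> n Z)"
proof -
  interpret field_hom \<phi> by fact
  interpret P: map_poly_inj_idom_hom \<phi> ..
  have "card {0, 1 :: 'b} \<le> card (UNIV :: 'b set)"
    by (intro card_mono) auto
  then have n0: "n > 0"
    using n by simp
  have finZ: "finite Z"
    using Z finite_Omega finite_subset by blast
  have inj: "inj_on (\<lambda>i. \<beta> ^ i) Z"
    using primitive_element_inj_Omega[OF \<beta> n] Z by (rule inj_on_subset)
  have eq: "(\<Prod>z\<in>(\<lambda>i. \<beta> ^ i) ` Z. [:- z, 1:]) = (\<Prod>i\<in>Z. [:- (\<beta> ^ i), 1:])"
    using inj by (simp add: prod.reindex)
  have "\<exists>g. map_poly \<phi> g = (\<Prod>z\<in>(\<lambda>i. \<beta> ^ i) ` Z. [:- z, 1:])"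
  proof (rule prod_linear_descends[OF \<phi>])
    fix z
    assume "z \<in> (\<lambda>i. \<beta> ^ i) ` Z"
    then obtain i where i: "i \<in> Z" "z = \<beta> ^ i"
      by blast
    have "z ^ card (UNIV :: 'a set) = \<beta> ^ (card (UNIV :: 'a set) * i)"
      by (simp only: i(2) power_mult[symmetric] mult.commute)
    also have "\<dots> = \<beta> ^ (card (UNIV :: 'a set) * i mod (2 * n))"
      unfolding primitive_element_power_eq_iff[OF \<beta>] n by simp
    finally show "z ^ card (UNIV :: 'a set) \<in> (\<lambda>i. \<beta> ^ i) ` Z"
      using closed[OF i(1)] by blast
  qed (use finZ in simp)
  then obtain g where g: "map_poly \<phi> g = (\<Prod>i\<in>Z. [:- (\<beta> ^ i), 1:])"
    unfolding eq by blast
  have "map_poly \<phi> g dvd monom 1 n + 1"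
    unfolding g prod_Omega[OF \<beta> n, symmetric] using finite_Omega Z by (rule prod_dvd_prod_subset)
  moreover have "map_poly \<phi> (monom 1 n + 1) = monom 1 n + 1"
    by (simp add: P.hom_add)
  ultimately have dvd: "g dvd monom 1 n + 1"
    by (intro dvd_map_poly_hom_imp_dvd) simp
  have "degree (map_poly \<phi> g) = card Z"
    unfolding g by (simp add: degree_prod_eq_sum_degree)
  then have deg: "degree g = card Z"
    by simp
  have "\<phi> (lead_coeff g) = \<phi> 1"
    unfolding hom_lead_coeff[symmetric] g by (simp add: lead_coeff_prod)
  then have lead: "lead_coeff g = 1"
    unfolding eq_iff .
  let ?C = "range (\<lambda>a. word_of_poly n (a * g))"
  have neg: "negacyclic_code n ?C"
    by (rule negacyclic_code_range[OF n0])
  have C: "code_of_defining_set \<phi> \<beta> n Z = ?C"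
    unfolding code_of_defining_set_def
  proof (rule the_equality)
    show "negacyclic_code n ?C \<and> (\<exists>g. generator_poly n ?C g \<and> map_poly \<phi> g = (\<Prod>i\<in>Z. [:- (\<beta> ^ i), 1:]))"
      using neg lead dvd g unfolding generator_poly_def by blast
  next
    fix C'
    assume "negacyclic_code n C' \<and> (\<exists>g. generator_poly n C' g \<and> map_poly \<phi> g = (\<Prod>i\<in>Z. [:- (\<beta> ^ i), 1:]))"
    then obtain g' where g': "generator_poly n C' g'" "map_poly \<phi> g' = map_poly \<phi> g"
      unfolding g by blast
    have "g' = g"
      using g'(2) unfolding P.eq_iff .
    then show "C' = ?C"
      using g'(1) unfolding generator_poly_def by blast
  qed
  show ?thesis
    using that[OF g dvd deg C] neg unfolding C by blast
qed

theorem theorem10: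
  fixes \<phi> :: "'a :: {field, finite} \<Rightarrow> 'b :: {field, finite}" and \<beta> :: 'b
    and q m e l n :: nat and C :: "'a vec set"
  assumes "q = card (UNIV :: 'a set)" and "odd q" and "q \<ge> 5"
    and "m = 2 ^ e * l" and "l \<ge> 3" and "odd l" and "e \<ge> 1"
    and "card (UNIV :: 'b set) = q ^ m" and "field_hom \<phi>" and "primitive_element \<beta>"
    and "n = (q ^ m - 1) div 2"
    and "C = code_of_defining_set \<phi> \<beta> n (T_set q m 1)"
  shows "negacyclic_code n C
    \<and> real (code_dim n C) = (real q ^ m + (2 - real q) ^ m - 2) / 4
    \<and> min_dist C \<ge> q ^ ((m - 2 ^ e) div 2) + q
    \<and> linear_code n (dual_code n C)
    \<and> real (code_dim n (dual_code n C)) = (real q ^ m - (2 - real q) ^ m) / 4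
    \<and> min_dist (dual_code n C) \<ge> q ^ ((m - 2 ^ e) div 2) + q"
proof -
  note q = assms(1-3) and card = assms(8) and \<phi> = assms(9) and \<beta> = assms(10)
  obtain r where r: "l = 2 * r + 1"
    using assms(6) by (elim oddE)
  \<comment> \<open>With this \<open>s\<close> one has \<open>q ^ m = (q ^ s) ^ (2 * r + 1)\<close>
    and \<open>q ^ k = (q ^ s) ^ r\<close>, the form in which oddness of \<open>l\<close> yields the
    greatest common divisor 2. It is also the number of digits of the top block.\<close>
  define s where "s = (2 :: nat) ^ e"
  define k where "k = s * r"
  have s: "s \<ge> 2"
    using power_increasing[OF assms(7), of "2 :: nat"] by (simp add: s_def)
  have m: "s * (2 * r + 1) = m"
    using assms(4) r by (simp add: s_def)
  then have mk: "m = 2 * k + s"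
    by (simp add: k_def algebra_simps)
  then have kdef: "(m - 2 ^ e) div 2 = k"
    by (simp add: s_def)
  have k: "k \<ge> 1"
    using s assms(5) r by (simp add: k_def)
  have "q ^ m \<ge> 1" "odd (q ^ m)"
    using q by simp_all
  then have n2: "2 * n = q ^ m - 1" and n: "card (UNIV :: 'b set) = 2 * n + 1"
    unfolding card assms(11) by simp_all
  have "q ^ 1 \<le> q ^ m"
    using q mk s by (intro power_increasing) auto
  then have n0: "n > 0"
    using n2 q by simp
  have TO: "T_set q m i \<subseteq> Omega n" for i
    unfolding assms(11) by (rule T_set_subset_Omega)
  have closed: "card (UNIV :: 'a set) * i mod (2 * n) \<in> T_set q m 1" if "i \<in> T_set q m 1" for i
    using T_set_mult_q[OF q(2) _ that] mk s unfolding n2 q(1)[symmetric] by simp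
  obtain g where g: "map_poly \<phi> g = (\<Prod>i\<in>T_set q m 1. [:- (\<beta> ^ i), 1:])" "g dvd monom 1 n + 1"
    "degree g = card (T_set q m 1)" and Cg: "C = range (\<lambda>a. word_of_poly n (a * g))"
    and neg: "negacyclic_code n C"
    using code_of_defining_set_eq[OF \<phi> \<beta> n TO closed] assms(12) by metis
  have lin: "linear_code n C"
    using neg unfolding negacyclic_code_def by blast
  have linD: "linear_code n (dual_code n C)"
    using lin by (intro linear_code_dual) (simp add: linear_code_iff)
  have rn: "real n = (real q ^ m - 1) / 2"
  proof -
    have "real (2 * n) = real (q ^ m - 1)"
      unfolding n2 ..
    then show ?thesis
      using \<open>q ^ m \<ge> 1\<close> by (simp add: of_nat_diff)
  qed
  note cT = card_T_set[OF q(2), of m]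
  have sum: "card (T_set q m 0) + card (T_set q m 1) = n"
  proof -
    have "real (card (T_set q m 0) + card (T_set q m 1)) = real n"
      unfolding of_nat_add cT rn by (simp add: field_simps)
    then show ?thesis
      unfolding of_nat_eq_iff .
  qed
  have "q ^ code_dim n C = q ^ (n - card (T_set q m 1))"
    using linear_code_dim[OF lin] card_code_of_generator[OF n0 g(2)] unfolding Cg[symmetric] g(3) q(1)
    by simp
  then have dim: "code_dim n C = card (T_set q m 0)"
    using q sum by simp
  have dimD: "code_dim n (dual_code n C) = card (T_set q m 1)"
    using dual_code_dim[OF lin] dim sum by simp
  obtain b1 where b1: "\<And>j. j < q ^ k + q - 1 \<Longrightarrow> b1 + j * (q ^ k + 1) \<in> T_set q m 1"
    using T_set_progression(1)[OF q(2,3) k s] unfolding mk by blast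
  obtain b0 where b0: "\<And>j. j < q ^ k + q - 1 \<Longrightarrow> b0 + j * (q ^ k + 1) \<in> T_set q m 0"
    using T_set_progression(2)[OF q(2,3) k s] unfolding mk by blast
  have finT: "finite (T_set q m i)" for i
    using TO finite_Omega finite_subset by blast
  \<comment> \<open>Both dimensions are positive, so neither minimum distance is the default value
    0.\<close>
  have "card (T_set q m 1) > 0" "card (T_set q m 0) > 0"
    using b1[of 0] b0[of 0] finT q by (auto simp: card_gt_0_iff)
  moreover have "q > 1"
    using q(3) by simp
  ultimately have big: "card C > 1" "card (dual_code n C) > 1"
    unfolding linear_code_dim[OF lin] linear_code_dim[OF linD] dim dimD q(1)[symmetric]
    by (simp_all only: one_less_power)
  have \<beta>0: "\<beta> \<noteq> 0"
  proof
    assume "\<beta> = 0"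
    then have "(0 :: 'b) ^ n = -1"
      using primitive_element_half_power[OF \<beta> n] by simp
    then show False
      using n0 by (simp add: zero_power)
  qed
  have inj: "inj_on (\<lambda>j. (\<beta> ^ (q ^ k + 1)) ^ j) {..<n}"
    unfolding assms(11) k_def by (rule inj_on_primitive_element_power[OF \<beta> card q(2) m])
  have inj': "inj_on (\<lambda>j. ((1 / \<beta>) ^ (q ^ k + 1)) ^ j) {..<n}"
  proof (rule inj_onI)
    fix i j
    assume ij: "i \<in> {..<n}" "j \<in> {..<n}"
      and "((1 / \<beta>) ^ (q ^ k + 1)) ^ i = ((1 / \<beta>) ^ (q ^ k + 1)) ^ j"
    then have "1 / (\<beta> ^ (q ^ k + 1)) ^ i = 1 / (\<beta> ^ (q ^ k + 1)) ^ j"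
      by (simp only: power_one_over)
    then have "(\<beta> ^ (q ^ k + 1)) ^ i = (\<beta> ^ (q ^ k + 1)) ^ j"
      by (simp only: divide_cancel_left one_neq_zero simp_thms)
    then show "i = j"
      using inj_onD[OF inj] ij by blast
  qed
  have "q ^ k + q - 1 + 1 \<le> min_dist C"
  proof (rule min_dist_of_zeros[OF \<phi> lin big(1) \<beta>0 inj])
    fix c i
    assume c: "c \<in> C" and i: "i < q ^ k + q - 1"
    have "poly (map_poly \<phi> g) (\<beta> ^ t) = 0" if t: "t \<in> T_set q m 1" for t
      unfolding g(1) poly_prod by (rule prod_zero[OF finT bexI[OF _ t]]) simp
    from this[OF b1[OF i]] show "(\<Sum>j<n. \<phi> (c $ j) * (\<beta> ^ (b1 + i * (q ^ k + 1))) ^ j) = 0"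
      by (rule zeros_of_code[OF \<phi> n0 g(2) _ c[unfolded Cg]])
  qed
  moreover have "q ^ k + q - 1 + 1 \<le> min_dist (dual_code n C)"
  proof (rule min_dist_of_zeros[OF \<phi> linD big(2) _ inj'])
    fix c i
    assume c: "c \<in> dual_code n C" and i: "i < q ^ k + q - 1"
    define t where "t = b0 + i * (q ^ k + 1)"
    have t: "t \<in> T_set q m 0"
      unfolding t_def by (rule b0[OF i])
    then have "t \<in> Omega n" "t \<notin> T_set q m 1"
      using TO by (blast, simp add: T_set_def)
    have "[:- (\<beta> ^ t), 1:] * (\<Prod>i\<in>Omega n - {t}. [:- (\<beta> ^ i), 1:]) = monom 1 n + 1"
      unfolding prod_Omega[OF \<beta> n, symmetric] by (rule prod.remove[OF finite_Omega \<open>t \<in> Omega n\<close>, symmetric])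
    \<comment> \<open>An exponent of even weight is not in the defining set, so removing its linear
      factor from \<open>x^n + 1\<close> leaves a multiple of \<open>g\<close>.\<close>
    moreover have "map_poly \<phi> g dvd (\<Prod>i\<in>Omega n - {t}. [:- (\<beta> ^ i), 1:])"
      unfolding g(1) using TO \<open>t \<notin> T_set q m 1\<close> finite_Omega by (intro prod_dvd_prod_subset) auto
    ultimately have "(\<Sum>j<n. \<phi> (c $ j) * (1 / \<beta> ^ t) ^ j) = 0"
      using \<beta>0 by (intro zeros_of_dual_code[OF \<phi> n0 _ _ _ c[unfolded Cg]]) simp_all
    then show "(\<Sum>j<n. \<phi> (c $ j) * ((1 / \<beta>) ^ (b0 + i * (q ^ k + 1))) ^ j) = 0"
      unfolding t_def power_one_over .
  qed (use \<beta>0 in simp)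
  moreover have "q ^ k + q - 1 + 1 = q ^ k + q"
    using q by simp
  ultimately show ?thesis
    unfolding kdef dim dimD cT using neg linD by simp
qed

end
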